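(* Let $K$ be an algebraically closed field of characteristic $p=2$, let $k\ge3$ be odd and $n\ge2$, let $\lambda_1,\ldots,\lambda_{n-2}\in K\setminus\{0,1\}$ be pairwise different, and let $F_{k,n}=C^k_{\lambda_1,\ldots,\lambda_{n-2}}$ with Cartier operator $\mathscr{C}_{k,n}:H^{1,0}(F_{k,n})\to H^{1,0}(F_{k,n})$. Then $$a_{F_{k,n}}=\dim_K\ker(\mathscr{C}_{k,n})\ \ge\ \frac{(n-1)(k-1)}{4}\left(\frac{k+1}{2}\right)^{n-1}.$$
   Context: $C^k_{\lambda_1,\ldots,\lambda_{n-2}}\subset\mathbb{P}^n_K$ is the non-singular irreducible projective curve with equations $$x_1^k+x_2^k+x_3^k=0,\quad \lambda_1x_1^k+x_2^k+x_4^k=0,\ \ldots,\ \lambda_{n-2}x_1^k+x_2^k+x_{n+1}^k=0$$ (for $n=2$ it is the Fermat curve $x_1^k+x_2^k+x_3^k=0$). $H^{1,0}(X)$ denotes the $K$-space of holomorphic (everywhere regular) one-forms on $X$. Cartier operator in characteristic $p>0$: fix $z\in K(X)\setminus K(X)^p$. A holomorphic form can be written $w\,dz$ with $w=u_0^p+u_1^pz+\cdots+u_{p-1}^pz^{p-1}$, $u_i\in K(X)$; then $\mathscr{C}(w\,dz)=u_{p-1}\,dz$. It is a $1/p$-linear operator $H^{1,0}(X)\to H^{1,0}(X)$ independent of the choice of $z$ (so its kernel is a $K$-subspace). Its kernel is the space of exact holomorphic forms, and $a_X$ denotes the dimension of this kernel. *)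

theory Defs
  imports
    "HOL-Computational_Algebra.Polynomial"
    "HOL-Library.Poly_Mapping"
    "HOL-Library.Function_Algebras"
begin

section \<open>Homogeneous polynomials and projective point sets\<close>

text \<open>Multivariate polynomials; the variables are indexed by natural numbers.\<close>

type_synonym 'a mpoly = "(nat \<Rightarrow>\<^sub>0 nat) \<Rightarrow>\<^sub>0 'a"

definition eval_mpoly :: "('a::zero \<Rightarrow> 'b::comm_semiring_1) \<Rightarrow> (nat \<Rightarrow> 'b) \<Rightarrow> 'a mpoly \<Rightarrow> 'b" where
  "eval_mpoly \<iota> x F =
     (\<Sum>m\<in>Poly_Mapping.keys F. \<iota> (Poly_Mapping.lookup F m) *
        (\<Prod>i\<in>Poly_Mapping.keys m. x i ^ Poly_Mapping.lookup m i))"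

text \<open>The degree \<open>d\<close> part of the polynomial ring in \<open>x\<^sub>1, \<dots>, x\<^sub>N\<close>.\<close>

definition homogeneous :: "nat \<Rightarrow> nat \<Rightarrow> ('a::zero) mpoly set" where
  "homogeneous N d =
     {F. \<forall>m\<in>Poly_Mapping.keys F. Poly_Mapping.keys m \<subseteq> {1..N} \<and>
           (\<Sum>i\<in>Poly_Mapping.keys m. Poly_Mapping.lookup m i) = d}"

text \<open>A point of projective space of dimension \<open>N - 1\<close> is handled through its homogeneous
  coordinate vectors \<open>(x\<^sub>1, \<dots>, x\<^sub>N)\<close>, and a subset of projective space through the set of all
  coordinate vectors of its points. Everything below is invariant under rescaling the vector.\<close>

definition hcoords :: "nat \<Rightarrow> (nat \<Rightarrow> 'a::zero) set" where
  "hcoords N = {x. (\<forall>i. i \<notin> {1..N} \<longrightarrow> x i = 0) \<and> (\<exists>i. x i \<noteq> 0)}"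

text \<open>The first equation of the curve has coefficient \<open>1\<close>; \<open>l j\<close> is \<open>\<lambda>\<^sub>j\<close>.\<close>

definition fermat_curve :: "nat \<Rightarrow> nat \<Rightarrow> (nat \<Rightarrow> 'a::field) \<Rightarrow> (nat \<Rightarrow> 'a) set" where
  "fermat_curve k n l =
     {x \<in> hcoords (n + 1).
        x 1 ^ k + x 2 ^ k + x 3 ^ k = 0 \<and>
        (\<forall>j\<in>{1..n - 2}. l j * x 1 ^ k + x 2 ^ k + x (j + 3) ^ k = 0)}"

section \<open>Function field\<close>

text \<open>The field \<open>'f\<close> is (a copy of) the function field of the irreducible projective variety
  \<open>X\<close> over the algebraically closed field \<open>'a\<close>. Here \<open>\<iota>\<close> is the inclusion of the constants and
  \<open>\<xi>\<close> is a vector of homogeneous coordinates of the generic point: a form vanishes at \<open>\<xi>\<close> iff it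
  lies in the homogeneous ideal of \<open>X\<close>, and the elements of \<open>'f\<close> are the quotients \<open>G / H\<close> of
  forms of equal degree with \<open>H\<close> outside that ideal. These axioms determine \<open>'f\<close> up to
  isomorphism over \<open>'a\<close>, as the degree \<open>0\<close> part of the homogeneous localization at the zero
  ideal of the homogeneous coordinate ring of \<open>X\<close>.\<close>

locale function_field =
  fixes N :: nat and X :: "(nat \<Rightarrow> 'a::alg_closed_field) set"
    and \<iota> :: "'a \<Rightarrow> 'f::field" and \<xi> :: "nat \<Rightarrow> 'f"
  assumes const_one: "\<iota> 1 = 1"
    and const_add: "\<iota> (a + b) = \<iota> a + \<iota> b"
    and const_mult: "\<iota> (a * b) = \<iota> a * \<iota> b"
    and generic_point: "F \<in> homogeneous N d \<Longrightarrow>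
      eval_mpoly \<iota> \<xi> F = 0 \<longleftrightarrow> (\<forall>x\<in>X. eval_mpoly id x F = 0)"
    and quotient_of_forms: "\<exists>d. \<exists>G\<in>homogeneous N d. \<exists>H\<in>homogeneous N d.
      eval_mpoly \<iota> \<xi> H \<noteq> 0 \<and> f = eval_mpoly \<iota> \<xi> G / eval_mpoly \<iota> \<xi> H"

definition local_ring ::
    "nat \<Rightarrow> ('a::alg_closed_field \<Rightarrow> 'f::field) \<Rightarrow> (nat \<Rightarrow> 'f) \<Rightarrow> (nat \<Rightarrow> 'a) \<Rightarrow> 'f set" where
  "local_ring N \<iota> \<xi> P =
     {eval_mpoly \<iota> \<xi> G / eval_mpoly \<iota> \<xi> H | d G H.
        G \<in> homogeneous N d \<and> H \<in> homogeneous N d \<and> eval_mpoly id P H \<noteq> 0}"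

section \<open>Holomorphic one-forms\<close>

definition derivation :: "('a \<Rightarrow> 'f::field) \<Rightarrow> ('f \<Rightarrow> 'f) \<Rightarrow> bool" where
  "derivation \<iota> D \<longleftrightarrow>
     (\<forall>f g. D (f + g) = D f + D g) \<and> (\<forall>f g. D (f * g) = f * D g + g * D f) \<and>
     (\<forall>c. D (\<iota> c) = 0)"

text \<open>One-forms are realized as functionals on the space of derivations of the function field over
  the constants, which is a finite-dimensional vector space over the function field and dual to
  the space of one-forms. The value at a function that is not a derivation is set to \<open>0\<close>, so
  that equality of functions is equality of one-forms.\<close>

type_synonym 'f one_form = "('f \<Rightarrow> 'f) \<Rightarrow> 'f"

definition differential :: "('a \<Rightarrow> 'f::field) \<Rightarrow> 'f \<Rightarrow> 'f one_form" where
  "differential \<iota> g = (\<lambda>D. if derivation \<iota> D then D g else 0)"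

definition scale_form :: "'f::field \<Rightarrow> 'f one_form \<Rightarrow> 'f one_form" where
  "scale_form f \<omega> = (\<lambda>D. f * \<omega> D)"

definition regular_at :: "nat \<Rightarrow> ('a::alg_closed_field \<Rightarrow> 'f::field) \<Rightarrow> (nat \<Rightarrow> 'f) \<Rightarrow>
    (nat \<Rightarrow> 'a) \<Rightarrow> 'f one_form \<Rightarrow> bool" where
  "regular_at N \<iota> \<xi> P \<omega> \<longleftrightarrow>
     (\<exists>(m::nat) f g. (\<forall>i<m. f i \<in> local_ring N \<iota> \<xi> P \<and> g i \<in> local_ring N \<iota> \<xi> P) \<and>
        \<omega> = (\<Sum>i<m. scale_form (f i) (differential \<iota> (g i))))"

definition holomorphic_forms :: "nat \<Rightarrow> (nat \<Rightarrow> 'a::alg_closed_field) set \<Rightarrow>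
    ('a \<Rightarrow> 'f::field) \<Rightarrow> (nat \<Rightarrow> 'f) \<Rightarrow> 'f one_form set" where
  "holomorphic_forms N X \<iota> \<xi> = {\<omega>. \<forall>P\<in>X. regular_at N \<iota> \<xi> P \<omega>}"

section \<open>Cartier operator\<close>

text \<open>To be used for \<open>z\<close> outside the field of \<open>p\<close>-th powers; there the coefficients \<open>u i\<close> exist
  and are unique on a curve.\<close>

definition cartier :: "('a \<Rightarrow> 'f::field) \<Rightarrow> 'f \<Rightarrow> 'f one_form \<Rightarrow> 'f one_form" where
  "cartier \<iota> z \<omega> =
     (THE \<eta>. \<exists>u. \<omega> = scale_form (\<Sum>i<CHAR('f). u i ^ CHAR('f) * z ^ i) (differential \<iota> z) \<and>
        \<eta> = scale_form (u (CHAR('f) - 1)) (differential \<iota> z))"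

definition cartier_kernel :: "nat \<Rightarrow> (nat \<Rightarrow> 'a::alg_closed_field) set \<Rightarrow>
    ('a \<Rightarrow> 'f::field) \<Rightarrow> (nat \<Rightarrow> 'f) \<Rightarrow> 'f \<Rightarrow> 'f one_form set" where
  "cartier_kernel N X \<iota> \<xi> z = {\<omega> \<in> holomorphic_forms N X \<iota> \<xi>. cartier \<iota> z \<omega> = 0}"

text \<open>The constants \<open>'a\<close> act on one-forms through \<open>\<iota>\<close>.\<close>

definition a_number :: "nat \<Rightarrow> (nat \<Rightarrow> 'a::alg_closed_field) set \<Rightarrow>
    ('a \<Rightarrow> 'f::field) \<Rightarrow> (nat \<Rightarrow> 'f) \<Rightarrow> 'f \<Rightarrow> nat" where
  "a_number N X \<iota> \<xi> z =
     vector_space.dim (\<lambda>c. scale_form (\<iota> c)) (cartier_kernel N X \<iota> \<xi> z)"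

lemma (in function_field) vector_space_scale_form: "vector_space (\<lambda>c. scale_form (\<iota> c))"
  by unfold_locales
    (simp_all add: scale_form_def fun_eq_iff const_one const_add const_mult algebra_simps)

end

theory Submission
  imports Defs "HOL-Library.FuncSet"
begin

text \<open>
  Put \<open>k = 2 m + 1\<close>. In the affine coordinates \<open>T = x\<^sub>1 / x\<^sub>2\<close> and \<open>Y\<^sub>i = x\<^sub>i / x\<^sub>2\<close>, \<open>3 \<le> i \<le> n + 1\<close>, the curve
  is given by \<open>Y\<^sub>i\<^sup>k = L\<^sub>i T\<^sup>k + 1\<close>, where \<open>L\<^sub>3 = 1\<close> and the other \<open>L\<^sub>i\<close> are the parameters. In
  characteristic two the Cartier operator kills every form \<open>w\<^sup>2 dT\<close>. The bound counts the forms with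
  \<open>w = T\<^sup>b / \<Prod> Y\<^sub>i\<^bsup>c\<^sub>i\<^esup>\<close>, \<open>0 \<le> c\<^sub>i \<le> m\<close>, \<open>0 \<le> b < \<Sum> c\<^sub>i\<close>: these are the monomial forms
  \<open>x\<^sup>a dT / \<Prod> Y\<^sub>i\<^bsup>k-1\<^esup>\<close> all of whose exponents are even. They are regular (\<open>square_form_regular\<close>) and
  linearly independent (\<open>square_forms_independent\<close>), and by the symmetry \<open>c \<mapsto> m - c\<close> there are
  \<open>(n - 1) (m / 2) (m + 1)\<^bsup>n-1\<^esup>\<close> of them (\<open>card_expos\<close>), which is the asserted number.

  A large independent set bounds a dimension from below only if the dimension is finite, because
  the dimension of an infinite-dimensional space is defined to be zero. Most of the development
  therefore shows that the space of holomorphic forms is finite-dimensional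
  (\<open>holomorphic_in_span\<close>). The starting point is a local statement (\<open>coefficients_vanish\<close>): if
  \<open>\<Sum>\<^sub>e p\<^sub>e(T) Y\<^sup>e\<close>, with all exponents less than \<open>k\<close>, is divisible by \<open>T - t\<close> at all points over
  \<open>t\<close>, then \<open>p\<^sub>e(t) = 0\<close> for all \<open>e\<close>. Where no \<open>Y\<^sub>i\<close> vanishes, each \<open>Y\<^sub>i\<close> takes \<open>k\<close> distinct values over
  \<open>t\<close> independently, and a polynomial of degree less than \<open>k\<close> in each variable that vanishes on
  such a grid is zero; where some \<open>Y\<^sub>a\<close> vanishes, \<open>Y\<^sub>a\<^sup>k\<close> is a unit times \<open>T - t\<close> and one compares
  the powers of \<open>Y\<^sub>a\<close> one after the other. It follows that the \<open>Y\<^sup>e\<close> are a basis of the functions over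
  the rational functions in \<open>T\<close>, that functions regular on the affine part have polynomial
  coefficients (\<open>regular_on_affine_part_imp_comb\<close>), and, by the same argument at infinity, that a
  bound on the poles at infinity bounds the degrees (\<open>bounded_pole_imp_V\<close>).

  Forms become functions through a derivation \<open>DT\<close> with \<open>DT(T) = 1\<close>. Constants are squares and
  \<open>Y\<^sub>i = Y\<^sub>i\<^sup>k (1 / Y\<^sub>i\<^sup>m)\<^sup>2\<close>, so every function is \<open>a\<^sup>2 + b\<^sup>2 T\<close>; since some function is not a square,
  \<open>T\<close> is not a square, the representation is unique, and \<open>DT(a\<^sup>2 + b\<^sup>2 T) = b\<^sup>2\<close> is well defined. All
  forms are multiples of \<open>dT\<close>, and differentiating \<open>Y\<^sub>i\<^sup>k = L\<^sub>i T\<^sup>k + 1\<close> shows that \<open>DT\<close> has bounded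
  poles. Hence the coefficients \<open>h\<close> of holomorphic forms \<open>h dT\<close> have bounded poles.
\<close>

section \<open>Algebraic preliminaries\<close>

lemma (in vector_space) independent_family:
  assumes "finite I" "\<And>u i. (\<Sum>i\<in>I. scale (u i) (v i)) = 0 \<Longrightarrow> i \<in> I \<Longrightarrow> u i = 0"
  shows "inj_on v I" "independent (v ` I)"
proof -
  show inj: "inj_on v I"
  proof (rule inj_onI, rule ccontr)
    fix i j assume ij: "i \<in> I" "j \<in> I" "v i = v j" "i \<noteq> j"
    define u :: "_ \<Rightarrow> 'a" where "u = (\<lambda>x. if x = i then 1 else if x = j then - 1 else 0)"
    have "(\<Sum>x\<in>I. scale (u x) (v x)) = (\<Sum>x\<in>{i, j}. scale (u x) (v x))"
      by (rule sum.mono_neutral_right) (use ij assms(1) in \<open>auto simp: u_def\<close>)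
    also have "\<dots> = 0" using ij by (simp add: u_def)
    finally have "u i = 0" using assms(2) ij(1) by blast
    then show False by (simp add: u_def)
  qed
  show "independent (v ` I)"
  proof (rule independent_if_scalars_zero)
    fix f x assume f: "(\<Sum>x\<in>v ` I. scale (f x) x) = 0" and x: "x \<in> v ` I"
    have "(\<Sum>i\<in>I. scale (f (v i)) (v i)) = 0" using f by (simp add: sum.reindex[OF inj] o_def)
    then show "f x = 0" using assms(2)[of "f \<circ> v"] x by auto
  qed (use assms(1) in simp)
qed

text \<open>Stated for families instead of sets, so that repeated vectors count as a relation.\<close>

lemma (in vector_space) nontrivial_relation:
  assumes "finite I" "finite S" "card S < card I" "\<And>i. i \<in> I \<Longrightarrow> v i \<in> span S"
  shows "\<exists>c. (\<Sum>i\<in>I. scale (c i) (v i)) = 0 \<and> (\<exists>i\<in>I. c i \<noteq> 0)"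
proof (rule ccontr)
  assume rel: "\<not> ?thesis"
  then have *: "c i = 0" if "(\<Sum>i\<in>I. scale (c i) (v i)) = 0" "i \<in> I" for c i
    using that rel by blast
  have family: "inj_on v I" "independent (v ` I)"
    using independent_family[of I v] assms(1) * by blast+
  have "card (v ` I) \<le> card S"
    using independent_span_bound[OF assms(2) family(2)] assms(4) by blast
  then show False using card_image[OF family(1)] assms(3) by simp
qed

text \<open>The polynomial \<open>x\<^sup>k - a\<close> splits, and a double root would be a root of its derivative
  \<open>k x\<^bsup>k-1\<^esup>\<close> as well, hence zero.\<close>

lemma card_kth_roots:
  fixes a :: "'a::alg_closed_field"
  assumes "a \<noteq> 0" "k > 0" "(of_nat k :: 'a) \<noteq> 0"
  shows "card {x. x ^ k = a} = k"
proof -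
  define p where "p = monom (1::'a) k - [:a:]"
  have poly_p: "poly p x = x ^ k - a" for x
    by (simp add: p_def poly_monom)
  have dp: "poly (pderiv p) x = of_nat k * x ^ (k - 1)" for x
    by (simp add: p_def pderiv_diff pderiv_monom poly_monom pderiv_pCons)
  have deg: "degree p = k"
    unfolding p_def diff_conv_add_uminus using assms(2)
    by (subst degree_add_eq_left) (auto simp: degree_monom_eq)
  then have "p \<noteq> 0" using assms(2) by auto
  then obtain A where A: "size A = k" "p = smult (lead_coeff p) (\<Prod>x\<in>#A. [:-x, 1:])"
    using alg_closed_imp_factorization[of p] deg by auto
  have cnt: "count A x = 1" if x: "x \<in># A" for x
  proof (rule ccontr)
    assume ne: "count A x \<noteq> 1"
    obtain A' where A': "A = add_mset x A'" using multi_member_split[OF x] by blast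
    have "count A' x \<noteq> 0" using ne by (simp add: A')
    then have xA': "x \<in># A'" by simp
    obtain A'' where A'': "A' = add_mset x A''" using multi_member_split[OF xA'] by blast
    define q where "q = smult (lead_coeff p) (\<Prod>x\<in>#A''. [:-x, 1:])"
    have pq: "p = [:-x, 1:] * ([:-x, 1:] * q)"
      using A(2) unfolding A' A'' q_def by simp
    have "poly p x = 0" "poly (pderiv p) x = 0"
      by (subst pq, simp) (subst pq, subst pderiv_mult, simp)
    then show False using assms by (auto simp: poly_p dp)
  qed
  have "x \<in># A \<longleftrightarrow> x ^ k = a" for x
  proof -
    have "poly p x = lead_coeff p * (\<Prod>y\<in>#A. x - y)"
      by (subst A(2)) (simp add: poly_prod_mset)
    moreover have "(\<Prod>y\<in>#A. x - y) = 0 \<longleftrightarrow> x \<in># A" by (auto simp: prod_mset_zero_iff)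
    ultimately have "poly p x = 0 \<longleftrightarrow> x \<in># A"
      using \<open>p \<noteq> 0\<close> by (simp only: mult_eq_0_iff leading_coeff_0_iff simp_thms)
    then show ?thesis by (simp add: poly_p)
  qed
  then have "{x. x ^ k = a} = set_mset A" by auto
  then show ?thesis
    using A(1) cnt by (simp add: size_multiset_overloaded_eq)
qed

lemma sum_PiE_insert:
  assumes "i \<notin> I"
  shows "(\<Sum>e\<in>Pi\<^sub>E (insert i I) B. f e) = (\<Sum>j\<in>B i. \<Sum>e\<in>Pi\<^sub>E I B. f (e(i := j)))"
proof -
  have "(\<Sum>e\<in>Pi\<^sub>E (insert i I) B. f e) = (\<Sum>(j, e)\<in>B i \<times> Pi\<^sub>E I B. f (e(i := j)))"
    unfolding PiE_insert_eq
    using inj_combinator[OF assms, of B] by (subst sum.reindex) (auto simp: o_def case_prod_unfold)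
  then show ?thesis by (simp add: sum.cartesian_product)
qed

text \<open>A polynomial of degree less than \<open>k\<close> in each variable is determined by its values on a
  grid with at least \<open>k\<close> points in each direction: fix all but one variable and count roots.\<close>

lemma vanishing_on_grid:
  fixes c :: "('i \<Rightarrow> nat) \<Rightarrow> 'a::idom"
  assumes "finite I" "\<And>i. i \<in> I \<Longrightarrow> k \<le> card (S i)"
    and "\<And>r. r \<in> Pi\<^sub>E I S \<Longrightarrow> (\<Sum>e\<in>Pi\<^sub>E I (\<lambda>_. {..<k}). c e * (\<Prod>i\<in>I. r i ^ e i)) = 0"
    and "e \<in> Pi\<^sub>E I (\<lambda>_. {..<k})"
  shows "c e = 0"
  using assms
proof (induction I arbitrary: c e rule: finite_induct)
  case empty
  then show ?case by simp
next
  case (insert i I)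
  let ?B = "\<lambda>I. Pi\<^sub>E I (\<lambda>_. {..<k})"
  have "(\<Sum>e\<in>?B I. c (e(i := j)) * (\<Prod>i\<in>I. r i ^ e i)) = 0" if r: "r \<in> Pi\<^sub>E I S" and j: "j < k" for r j
  proof -
    define p where "p = (\<Sum>j<k. monom (\<Sum>e\<in>?B I. c (e(i := j)) * (\<Prod>i\<in>I. r i ^ e i)) j)"
    have "poly p x = 0" if x: "x \<in> S i" for x
    proof -
      have "r(i := x) \<in> Pi\<^sub>E (insert i I) S"
        using r x by (auto simp: PiE_iff extensional_def)
      then have "0 = (\<Sum>e\<in>?B (insert i I). c e * (\<Prod>l\<in>insert i I. (r(i := x)) l ^ e l))"
        by (rule insert.prems(2)[THEN sym])
      also have "\<dots> = (\<Sum>j<k. \<Sum>e\<in>?B I. c (e(i := j)) * (\<Prod>l\<in>insert i I. (r(i := x)) l ^ (e(i := j)) l))"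
        by (rule sum_PiE_insert[OF insert.hyps(2)])
      also have "\<dots> = (\<Sum>j<k. \<Sum>e\<in>?B I. c (e(i := j)) * (x ^ j * (\<Prod>l\<in>I. r l ^ e l)))"
      proof (intro sum.cong refl arg_cong2[where f="(*)"])
        fix j e
        have "(\<Prod>l\<in>I. (r(i := x)) l ^ (e(i := j)) l) = (\<Prod>l\<in>I. r l ^ e l)"
          by (rule prod.cong) (use insert.hyps(2) in auto)
        then show "(\<Prod>l\<in>insert i I. (r(i := x)) l ^ (e(i := j)) l) = x ^ j * (\<Prod>l\<in>I. r l ^ e l)"
          using insert.hyps by simp
      qed
      also have "\<dots> = poly p x"
        by (simp add: p_def poly_sum poly_monom sum_distrib_right sum_distrib_left mult_ac)
      finally show ?thesis by simp
    qed
    have "p = 0"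
    proof (rule ccontr)
      assume p: "p \<noteq> 0"
      have "coeff p l = 0" if "l \<ge> k" for l
        using that by (auto simp: p_def coeff_sum intro!: sum.neutral)
      then have "degree p \<le> k - 1" by (intro degree_le) auto
      moreover have "card (S i) \<le> degree p"
      proof -
        have "S i \<subseteq> {x. poly p x = 0}" using \<open>\<And>x. x \<in> S i \<Longrightarrow> poly p x = 0\<close> by auto
        then show ?thesis
          using card_mono[OF poly_roots_finite[OF p]] card_poly_roots_bound[OF p] by (meson le_trans)
      qed
      ultimately show False using j insert.prems(1)[of i] by simp
    qed
    then have "coeff p j = 0" by simp
    then show ?thesis using j by (simp add: p_def coeff_sum)
  qed
  note * = this
  have e: "e i < k" "restrict e I \<in> ?B I" using insert.prems(3) by auto
  have "c ((restrict e I)(i := e i)) = 0"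
    by (rule insert.IH[where c="\<lambda>f. c (f(i := e i))"]) (use * e insert.prems(1) in auto)
  moreover have "(restrict e I)(i := e i) = e"
    using insert.prems(3) insert.hyps(2) by (auto simp: fun_eq_iff PiE_iff extensional_def restrict_def)
  ultimately show ?case by simp
qed

lemma diff_eq_diff_if_add_eq_add: "x + y = u + v \<Longrightarrow> y - v = u - x" for x :: "'a::ab_group_add"
  by (simp add: algebra_simps)

text \<open>The reflection \<open>c \<mapsto> m - c\<close> of the box pairs a coordinate sum \<open>s\<close> with \<open>card I * m - s\<close>.\<close>

lemma sum_over_box:
  assumes "finite I"
  shows "2 * (\<Sum>c\<in>Pi\<^sub>E I (\<lambda>_. {..m}). sum c I) = card I * m * (m + 1) ^ card I"
proof -
  let ?B = "Pi\<^sub>E I (\<lambda>_. {..m})"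
  have "(\<Sum>c\<in>?B. sum c I) = (\<Sum>c\<in>?B. \<Sum>i\<in>I. m - c i)"
  proof (rule sum.reindex_bij_witness[where i="\<lambda>c. \<lambda>i\<in>I. m - c i" and j="\<lambda>c. \<lambda>i\<in>I. m - c i"])
    fix c assume c: "c \<in> ?B"
    show r: "(\<lambda>i\<in>I. m - (\<lambda>i\<in>I. m - c i) i) = c" "(\<lambda>i\<in>I. m - (\<lambda>i\<in>I. m - c i) i) = c"
      using c by (auto simp: fun_eq_iff PiE_iff extensional_def restrict_def)
    show "(\<lambda>i\<in>I. m - c i) \<in> ?B" "(\<lambda>i\<in>I. m - c i) \<in> ?B" by auto
    show "(\<Sum>i\<in>I. m - (\<lambda>i\<in>I. m - c i) i) = sum c I"
      using c by (intro sum.cong) (auto simp: PiE_iff)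
  qed
  then have "2 * (\<Sum>c\<in>?B. sum c I) = (\<Sum>c\<in>?B. \<Sum>i\<in>I. c i + (m - c i))"
    by (simp add: sum.distrib)
  also have "\<dots> = (\<Sum>c\<in>?B. \<Sum>i\<in>I. m)"
    by (intro sum.cong refl) (auto simp: PiE_iff)
  also have "\<dots> = card I * m * (m + 1) ^ card I"
    using assms by (simp add: card_PiE mult_ac)
  finally show ?thesis .
qed

section \<open>Evaluation of multivariate polynomials\<close>

definition eval_monom :: "(nat \<Rightarrow> 'b::comm_semiring_1) \<Rightarrow> (nat \<Rightarrow>\<^sub>0 nat) \<Rightarrow> 'b" where
  "eval_monom x m = (\<Prod>i\<in>Poly_Mapping.keys m. x i ^ Poly_Mapping.lookup m i)"

lemma eval_monom_superset:
  assumes "finite A" "Poly_Mapping.keys m \<subseteq> A"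
  shows "eval_monom x m = (\<Prod>i\<in>A. x i ^ Poly_Mapping.lookup m i)"
  unfolding eval_monom_def
  by (rule prod.mono_neutral_left) (use assms in \<open>auto simp: in_keys_iff\<close>)

lemma eval_monom_add: "eval_monom x (m + m') = eval_monom x m * eval_monom x m'"
proof -
  define A where "A = Poly_Mapping.keys m \<union> Poly_Mapping.keys m'"
  have "finite A" "Poly_Mapping.keys m \<subseteq> A" "Poly_Mapping.keys m' \<subseteq> A" "Poly_Mapping.keys (m + m') \<subseteq> A"
    using keys_add[of m m'] by (auto simp: A_def)
  then show ?thesis
    by (simp add: eval_monom_superset[of A] lookup_add power_add prod.distrib)
qed

text \<open>Used for dehomogenization: dividing all variables by one of them divides a form by the
  power of that variable given by its degree.\<close>

lemma eval_monom_scaled: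
  assumes "\<And>i. i \<in> Poly_Mapping.keys m \<Longrightarrow> x i = c * y i"
  shows "eval_monom x m =
    c ^ (\<Sum>i\<in>Poly_Mapping.keys m. Poly_Mapping.lookup m i) * eval_monom y m"
  unfolding eval_monom_def
  by (simp add: assms power_mult_distrib prod.distrib power_sum cong: prod.cong)

lemma eval_mpoly_superset:
  assumes "finite A" "Poly_Mapping.keys F \<subseteq> A" "\<iota> 0 = 0"
  shows "eval_mpoly \<iota> x F = (\<Sum>m\<in>A. \<iota> (Poly_Mapping.lookup F m) * eval_monom x m)"
  unfolding eval_mpoly_def eval_monom_def[symmetric]
  by (rule sum.mono_neutral_left) (use assms in \<open>auto simp: in_keys_iff\<close>)

lemma eval_mpoly_single:
  assumes "\<iota> 0 = 0"
  shows "eval_mpoly \<iota> x (Poly_Mapping.single m a) = \<iota> a * eval_monom x m"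
  by (subst eval_mpoly_superset[of "{m}"]) (use assms in auto)

lemma eval_mpoly_add:
  assumes "\<iota> 0 = 0" "\<And>a b. \<iota> (a + b) = \<iota> a + \<iota> b"
  shows "eval_mpoly \<iota> x (F + G) = eval_mpoly \<iota> x F + eval_mpoly \<iota> x G"
proof -
  define A where "A = Poly_Mapping.keys F \<union> Poly_Mapping.keys G"
  have "finite A" "Poly_Mapping.keys F \<subseteq> A" "Poly_Mapping.keys G \<subseteq> A" "Poly_Mapping.keys (F + G) \<subseteq> A"
    using keys_add[of F G] by (auto simp: A_def)
  then show ?thesis
    by (simp add: eval_mpoly_superset[of A] assms lookup_add distrib_right sum.distrib)
qed

lemma poly_mapping_eq_sum_single:
  "F = (\<Sum>m\<in>Poly_Mapping.keys F. Poly_Mapping.single m (Poly_Mapping.lookup F m))"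
  by (rule poly_mapping_eqI)
     (auto simp: lookup_sum lookup_single when_def in_keys_iff sum.delta)

lemma eval_mpoly_sum:
  assumes "\<iota> 0 = 0" "\<And>a b. \<iota> (a + b) = \<iota> a + \<iota> b"
  shows "eval_mpoly \<iota> x (\<Sum>i\<in>A. F i) = (\<Sum>i\<in>A. eval_mpoly \<iota> x (F i))"
  by (induction A rule: infinite_finite_induct)
     (simp_all add: eval_mpoly_add assms, simp_all add: eval_mpoly_def)

lemma eval_mpoly_mult:
  assumes "\<iota> 0 = 0" "\<And>a b. \<iota> (a + b) = \<iota> a + \<iota> b" "\<And>a b. \<iota> (a * b) = \<iota> a * \<iota> b"
  shows "eval_mpoly \<iota> x (F * G) = eval_mpoly \<iota> x F * eval_mpoly \<iota> x G"
proof -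
  have "F * G = (\<Sum>m\<in>Poly_Mapping.keys F. \<Sum>m'\<in>Poly_Mapping.keys G.
      Poly_Mapping.single (m + m') (Poly_Mapping.lookup F m * Poly_Mapping.lookup G m'))"
    by (subst poly_mapping_eq_sum_single[of F], subst poly_mapping_eq_sum_single[of G])
       (simp add: sum_product mult_single)
  then show ?thesis
    by (simp add: eval_mpoly_sum eval_mpoly_single assms eval_monom_add)
       (simp add: eval_mpoly_def eval_monom_def[symmetric] sum_product mult_ac)
qed

lemma homogeneous_add:
  assumes "F \<in> homogeneous N d" "G \<in> homogeneous N d"
  shows "F + G \<in> homogeneous N d"
  using assms keys_add[of F G] unfolding homogeneous_def by blast

lemma homogeneous_mult:
  assumes "F \<in> homogeneous N d" "G \<in> homogeneous N d'"
  shows "F * G \<in> homogeneous N (d + d')"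
  unfolding homogeneous_def
proof (clarify, goal_cases)
  case (1 m)
  then obtain a b where ab: "a \<in> Poly_Mapping.keys F" "b \<in> Poly_Mapping.keys G" "m = a + b"
    using keys_mult[of F G] by blast
  let ?s = "\<lambda>m. \<Sum>i\<in>Poly_Mapping.keys m. Poly_Mapping.lookup m i"
  have k: "Poly_Mapping.keys a \<subseteq> {1..N}" "Poly_Mapping.keys b \<subseteq> {1..N}" "?s a = d" "?s b = d'"
    using ab(1,2) assms by (auto simp: homogeneous_def)
  have km: "Poly_Mapping.keys m \<subseteq> {1..N}" using keys_add[of a b] k ab(3) by blast
  have s: "?s c = (\<Sum>i\<in>{1..N}. Poly_Mapping.lookup c i)" if "Poly_Mapping.keys c \<subseteq> {1..N}" for c
    by (rule sum.mono_neutral_left) (use that in \<open>auto simp: in_keys_iff\<close>)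
  have "?s m = d + d'"
  proof -
    have "?s m = (\<Sum>i\<in>{1..N}. Poly_Mapping.lookup a i + Poly_Mapping.lookup b i)"
      by (subst s[OF km]) (simp add: ab(3) lookup_add)
    then show ?thesis using k(3,4) by (simp only: s[OF k(1)] s[OF k(2)] sum.distrib)
  qed
  with km show ?case by simp
qed

definition const_mpoly :: "'a::zero \<Rightarrow> 'a mpoly" where
  "const_mpoly c = Poly_Mapping.single 0 c"

definition var_mpoly :: "nat \<Rightarrow> 'a::{zero,one} mpoly" where
  "var_mpoly i = Poly_Mapping.single (Poly_Mapping.single i 1) 1"

lemma const_homogeneous: "const_mpoly c \<in> homogeneous N 0"
  by (auto simp: homogeneous_def const_mpoly_def)

lemma const_mpoly_one: "const_mpoly 1 = (1 :: 'a::zero_neq_one mpoly)"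
  by (simp add: const_mpoly_def)

lemma var_homogeneous: "i \<in> {1..N} \<Longrightarrow> var_mpoly i \<in> homogeneous N 1"
  by (auto simp: homogeneous_def var_mpoly_def split: if_splits)

lemma eval_var: "\<iota> 0 = 0 \<Longrightarrow> \<iota> 1 = 1 \<Longrightarrow> eval_mpoly \<iota> x (var_mpoly i) = x i"
  by (simp add: eval_mpoly_single eval_monom_def var_mpoly_def)

lemma eval_const: "\<iota> 0 = 0 \<Longrightarrow> eval_mpoly \<iota> x (const_mpoly c) = \<iota> c"
  by (simp add: eval_mpoly_single eval_monom_def const_mpoly_def)

section \<open>Values of functions at points\<close>

definition subring_over :: "('a \<Rightarrow> 'f::field) \<Rightarrow> 'f set \<Rightarrow> bool" where
  "subring_over \<iota> R \<longleftrightarrow> range \<iota> \<subseteq> R \<and> (\<forall>f\<in>R. \<forall>g\<in>R. f + g \<in> R \<and> f * g \<in> R)"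

lemma subring_overD:
  assumes "subring_over \<iota> R"
  shows "\<iota> c \<in> R" "f \<in> R \<Longrightarrow> g \<in> R \<Longrightarrow> f + g \<in> R" "f \<in> R \<Longrightarrow> g \<in> R \<Longrightarrow> f * g \<in> R"
  using assms by (auto simp: subring_over_def)

lemma subring_over_sum:
  assumes "subring_over \<iota> R" "\<iota> 0 = 0"
  shows "(\<And>i. i \<in> A \<Longrightarrow> f i \<in> R) \<Longrightarrow> sum f A \<in> R"
  using subring_overD[OF assms(1)] subring_overD(1)[OF assms(1), of 0] assms(2)
  by (induction A rule: infinite_finite_induct) auto

lemma subring_over_prod:
  assumes "subring_over \<iota> R" "\<iota> 1 = 1"
  shows "(\<And>i. i \<in> A \<Longrightarrow> f i \<in> R) \<Longrightarrow> prod f A \<in> R"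
  using subring_overD[OF assms(1)] subring_overD(1)[OF assms(1), of 1] assms(2)
  by (induction A rule: infinite_finite_induct) auto

lemma subring_over_power:
  assumes "subring_over \<iota> R" "\<iota> 1 = 1" "f \<in> R"
  shows "f ^ j \<in> R"
  using subring_overD[OF assms(1)] subring_overD(1)[OF assms(1), of 1] assms(2,3)
  by (induction j) auto

definition dehomogenized :: "(nat \<Rightarrow> 'f::field) \<Rightarrow> nat \<Rightarrow> nat \<Rightarrow> 'f" where
  "dehomogenized \<xi> b i = \<xi> i / \<xi> b"

context function_field
begin

lemma const_zero [simp]: "\<iota> 0 = 0"
  using const_add[of 0 0] by (metis add.right_neutral add_left_imp_eq)

lemma const_uminus: "\<iota> (- a) = - \<iota> a"
  using const_add[of a "- a"] by (simp add: eq_neg_iff_add_eq_0 add.commute)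

lemma const_eq_0_iff [simp]: "\<iota> a = 0 \<longleftrightarrow> a = 0"
proof
  assume "\<iota> a = 0"
  then show "a = 0"
    using const_mult[of a "inverse a"] const_one by (cases "a = 0") auto
qed simp

lemma const_power: "\<iota> (a ^ j) = \<iota> a ^ j"
  by (induction j) (simp_all add: const_one const_mult)

lemma const_of_nat: "\<iota> (of_nat j) = of_nat j"
  by (induction j) (simp_all add: const_one const_add)

abbreviation ev :: "'a mpoly \<Rightarrow> 'f" where "ev \<equiv> eval_mpoly \<iota> \<xi>"
abbreviation evp :: "(nat \<Rightarrow> 'a) \<Rightarrow> 'a mpoly \<Rightarrow> 'a" where "evp \<equiv> eval_mpoly id"

lemmas ev_simps =
  eval_mpoly_add[of \<iota>, OF const_zero const_add] eval_mpoly_mult[of \<iota>, OF const_zero const_add const_mult]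
  eval_var[of \<iota>, OF const_zero const_one] eval_const[of \<iota>, OF const_zero]

lemma evp_simps:
  "evp P (F + G) = evp P F + evp P G" "evp P (F * G) = evp P F * evp P G"
  "evp P (var_mpoly i) = P i"
  "evp P (const_mpoly c) = c"
  using eval_mpoly_add[of id P F G] eval_mpoly_mult[of id P F G] eval_var[of id P i] eval_const[of id P c]
  by simp_all

lemma ev_nonzero: "H \<in> homogeneous N d \<Longrightarrow> P \<in> X \<Longrightarrow> evp P H \<noteq> 0 \<Longrightarrow> ev H \<noteq> 0"
  using generic_point by blast

text \<open>Membership in the local ring at \<open>P\<close> together with the residue class, as a relation. All
  statements about local rings below go through values at points, so that no valuations occur.\<close>

definition has_value :: "(nat \<Rightarrow> 'a) \<Rightarrow> 'f \<Rightarrow> 'a \<Rightarrow> bool" where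
  "has_value P f c \<longleftrightarrow> (\<exists>d. \<exists>G\<in>homogeneous N d. \<exists>H\<in>homogeneous N d.
     evp P H \<noteq> 0 \<and> f = ev G / ev H \<and> c = evp P G / evp P H)"

lemma has_valueI:
  "G \<in> homogeneous N d \<Longrightarrow> H \<in> homogeneous N d \<Longrightarrow> evp P H \<noteq> 0 \<Longrightarrow>
     has_value P (ev G / ev H) (evp P G / evp P H)"
  unfolding has_value_def by blast

lemma local_ring_iff: "f \<in> local_ring N \<iota> \<xi> P \<longleftrightarrow> (\<exists>c. has_value P f c)"
  unfolding local_ring_def has_value_def by blast

text \<open>If \<open>G / H = G' / H'\<close> at the generic point, then the form \<open>G H' - G' H\<close> vanishes on \<open>X\<close>, in
  particular at \<open>P\<close>.\<close>

lemma has_value_unique: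
  assumes "P \<in> X" "has_value P f c" "has_value P f c'"
  shows "c = c'"
proof -
  obtain d G H where 1: "G \<in> homogeneous N d" "H \<in> homogeneous N d"
    "evp P H \<noteq> 0" "f = ev G / ev H" "c = evp P G / evp P H"
    using assms(2) unfolding has_value_def by blast
  obtain d' G' H' where 2: "G' \<in> homogeneous N d'" "H' \<in> homogeneous N d'"
    "evp P H' \<noteq> 0" "f = ev G' / ev H'" "c' = evp P G' / evp P H'"
    using assms(3) unfolding has_value_def by blast
  have nz: "ev H \<noteq> 0" "ev H' \<noteq> 0" using ev_nonzero assms(1) 1 2 by blast+
  define F where "F = G * H' + const_mpoly (- 1) * (G' * H)"
  have "const_mpoly (- 1) * (G' * H) \<in> homogeneous N (0 + (d' + d))"
    by (intro homogeneous_mult const_homogeneous 1 2)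
  then have F: "F \<in> homogeneous N (d + d')"
    unfolding F_def
    by (intro homogeneous_add homogeneous_mult[OF 1(1) 2(2)]) (simp add: add.commute)
  have "ev F = ev G * ev H' - ev G' * ev H"
    by (simp add: F_def ev_simps const_uminus const_one)
  also have "\<dots> = 0" using 1(4) 2(4) nz by (simp add: field_simps)
  finally have "evp P F = 0" using generic_point[OF F] assms(1) by blast
  then have "evp P G * evp P H' = evp P G' * evp P H"
    by (simp add: F_def evp_simps)
  then show ?thesis unfolding 1(5) 2(5) using 1(3) 2(3) by (simp add: frac_eq_eq)
qed

lemma has_value_const: "has_value P (\<iota> c) c"
  using has_valueI[OF const_homogeneous[of c] const_homogeneous[of 1]]
  by (simp add: ev_simps evp_simps const_one)

lemma has_value_add:
  assumes "P \<in> X" "has_value P f c" "has_value P g c'"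
  shows "has_value P (f + g) (c + c')"
proof -
  obtain d G H where 1: "G \<in> homogeneous N d" "H \<in> homogeneous N d"
    "evp P H \<noteq> 0" "f = ev G / ev H" "c = evp P G / evp P H"
    using assms(2) unfolding has_value_def by blast
  obtain d' G' H' where 2: "G' \<in> homogeneous N d'" "H' \<in> homogeneous N d'"
    "evp P H' \<noteq> 0" "g = ev G' / ev H'" "c' = evp P G' / evp P H'"
    using assms(3) unfolding has_value_def by blast
  have nz: "ev H \<noteq> 0" "ev H' \<noteq> 0" using ev_nonzero assms(1) 1 2 by blast+
  have *: "G * H' + H * G' \<in> homogeneous N (d + d')" "H * H' \<in> homogeneous N (d + d')"
    by (intro homogeneous_add homogeneous_mult 1 2)+
  show ?thesis
    using has_valueI[OF *, of P] 1(3-5) 2(3-5) nz by (simp add: ev_simps evp_simps add_frac_eq mult_ac)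
qed

lemma has_value_mult:
  assumes "has_value P f c" "has_value P g c'"
  shows "has_value P (f * g) (c * c')"
proof -
  obtain d G H where 1: "G \<in> homogeneous N d" "H \<in> homogeneous N d"
    "evp P H \<noteq> 0" "f = ev G / ev H" "c = evp P G / evp P H"
    using assms(1) unfolding has_value_def by blast
  obtain d' G' H' where 2: "G' \<in> homogeneous N d'" "H' \<in> homogeneous N d'"
    "evp P H' \<noteq> 0" "g = ev G' / ev H'" "c' = evp P G' / evp P H'"
    using assms(2) unfolding has_value_def by blast
  have *: "G * G' \<in> homogeneous N (d + d')" "H * H' \<in> homogeneous N (d + d')"
    by (intro homogeneous_mult 1 2)+
  show ?thesis
    using has_valueI[OF *, of P] 1 2 by (simp add: ev_simps evp_simps)
qed

lemma has_value_inverse: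
  assumes "has_value P f c" "c \<noteq> 0"
  shows "has_value P (inverse f) (inverse c)"
proof -
  obtain d G H where 1: "G \<in> homogeneous N d" "H \<in> homogeneous N d"
    "evp P H \<noteq> 0" "f = ev G / ev H" "c = evp P G / evp P H"
    using assms(1) unfolding has_value_def by blast
  show ?thesis
    using has_valueI[OF 1(2,1), of P] 1 assms(2) by simp
qed

lemma has_value_uminus:
  assumes "has_value P f c"
  shows "has_value P (- f) (- c)"
  using has_value_mult[OF has_value_const[of P "-1"] assms] by (simp add: const_uminus const_one)

lemma has_value_diff:
  assumes "P \<in> X" "has_value P f c" "has_value P g c'"
  shows "has_value P (f - g) (c - c')"
  using has_value_add[OF assms(1,2) has_value_uminus[OF assms(3)]] by simp

lemma has_value_power: "has_value P f c \<Longrightarrow> has_value P (f ^ j) (c ^ j)"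
  using has_value_const[of P 1] by (induction j) (auto simp: has_value_mult const_one)

lemma has_value_sum:
  assumes "P \<in> X"
  shows "(\<And>i. i \<in> A \<Longrightarrow> has_value P (f i) (c i)) \<Longrightarrow> has_value P (sum f A) (sum c A)"
  using has_value_const[of P 0]
  by (induction A rule: infinite_finite_induct) (auto simp: has_value_add[OF assms])

lemma has_value_prod:
  "(\<And>i. i \<in> A \<Longrightarrow> has_value P (f i) (c i)) \<Longrightarrow> has_value P (prod f A) (prod c A)"
  using has_value_const[of P 1]
  by (induction A rule: infinite_finite_induct) (auto simp: has_value_mult const_one)

lemma has_value_coordinate:
  assumes "i \<in> {1..N}" "b \<in> {1..N}" "P b \<noteq> 0"
  shows "has_value P (dehomogenized \<xi> b i) (P i / P b)"
  using has_valueI[OF var_homogeneous[OF assms(1)] var_homogeneous[OF assms(2)], of P] assms(3)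
  by (simp add: dehomogenized_def ev_simps evp_simps)

lemma coordinate_nonzero:
  assumes "i \<in> {1..N}" "P \<in> X" "P i \<noteq> 0"
  shows "\<xi> i \<noteq> 0"
  using ev_nonzero[OF var_homogeneous[OF assms(1)], of P] assms(2,3)
  by (simp add: ev_simps evp_simps)

text \<open>For \<open>f = G / H\<close> the form \<open>x\<^sub>b G H\<close> vanishes on \<open>X\<close>, so one of its factors is zero at the
  generic point. Identities between functions can therefore be checked pointwise.\<close>

lemma zero_if_values_zero:
  assumes b: "b \<in> {1..N}" "\<xi> b \<noteq> 0"
    and v: "\<And>P. P \<in> X \<Longrightarrow> P b \<noteq> 0 \<Longrightarrow> has_value P f 0"
  shows "f = 0"
proof -
  obtain d G H where GH: "G \<in> homogeneous N d" "H \<in> homogeneous N d" "ev H \<noteq> 0" "f = ev G / ev H"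
    using quotient_of_forms by blast
  let ?B = "var_mpoly b :: 'a mpoly"
  have hom: "?B * (G * H) \<in> homogeneous N (1 + (d + d))"
    by (intro homogeneous_mult var_homogeneous b GH)
  have "evp P (?B * (G * H)) = 0" if P: "P \<in> X" for P
  proof (cases "P b = 0 \<or> evp P H = 0")
    case True
    then show ?thesis by (auto simp: evp_simps)
  next
    case False
    then have "has_value P f (evp P G / evp P H)"
      using has_valueI[OF GH(1,2)] GH(4) by blast
    with False v[OF P] has_value_unique[OF P] have "evp P G / evp P H = 0" by blast
    with False show ?thesis by (simp add: evp_simps)
  qed
  then have "ev (?B * (G * H)) = 0" using generic_point[OF hom] by blast
  with b(2) GH(3,4) show ?thesis by (simp add: ev_simps)
qed

lemma dehomogenized_form_in_subring:
  assumes R: "subring_over \<iota> R" and b: "b \<in> {1..N}" "\<xi> b \<noteq> 0"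
    and gen: "\<And>i. i \<in> {1..N} \<Longrightarrow> dehomogenized \<xi> b i \<in> R"
    and G: "G \<in> homogeneous N d"
  shows "ev G / \<xi> b ^ d \<in> R"
proof -
  have "ev G / \<xi> b ^ d = (\<Sum>m\<in>Poly_Mapping.keys G. \<iota> (Poly_Mapping.lookup G m) *
      eval_monom (dehomogenized \<xi> b) m)"
    unfolding eval_mpoly_def eval_monom_def[symmetric] sum_divide_distrib
  proof (rule sum.cong[OF refl])
    fix m assume m: "m \<in> Poly_Mapping.keys G"
    have "eval_monom \<xi> m = \<xi> b ^ d * eval_monom (dehomogenized \<xi> b) m"
      using eval_monom_scaled[of m \<xi> "\<xi> b" "dehomogenized \<xi> b"] b(2) G m
      by (auto simp: dehomogenized_def homogeneous_def)
    then show "\<iota> (Poly_Mapping.lookup G m) * eval_monom \<xi> m / \<xi> b ^ d =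
        \<iota> (Poly_Mapping.lookup G m) * eval_monom (dehomogenized \<xi> b) m"
      using b(2) by simp
  qed
  also have "\<dots> \<in> R"
  proof (rule subring_over_sum[OF R])
    fix m assume m: "m \<in> Poly_Mapping.keys G"
    have "Poly_Mapping.keys m \<subseteq> {1..N}" using m G by (auto simp: homogeneous_def)
    then have "eval_monom (dehomogenized \<xi> b) m \<in> R"
      unfolding eval_monom_def
      by (intro subring_over_prod[OF R] subring_over_power[OF R] gen const_one) blast
    then show "\<iota> (Poly_Mapping.lookup G m) * eval_monom (dehomogenized \<xi> b) m \<in> R"
      using R by (auto simp: subring_over_def)
  qed simp
  finally show ?thesis .
qed

lemma evp_as_value:
  assumes P: "P \<in> X" and b: "b \<in> {1..N}" "P b \<noteq> 0" and G: "G \<in> homogeneous N d"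
  shows "has_value P (ev G / \<xi> b ^ d) (evp P G / P b ^ d)"
proof -
  have *: "(var_mpoly b :: 'a mpoly) ^ d \<in> homogeneous N d"
  proof (induction d)
    case (Suc d)
    then show ?case using homogeneous_mult[OF var_homogeneous[OF b(1)] Suc] by simp
  qed (use const_homogeneous[of "1 :: 'a" N] in \<open>simp add: const_mpoly_one\<close>)
  have **: "ev (var_mpoly b ^ d) = \<xi> b ^ d"
    "evp P (var_mpoly b ^ d) = P b ^ d"
    using eval_const[of \<iota> \<xi> 1] eval_const[of id P 1]
    by (induction d) (simp_all add: ev_simps evp_simps const_one const_mpoly_def)
  show ?thesis using has_valueI[OF G *, of P] b(2) by (simp add: **)
qed

text \<open>Induction principle for local rings: a form divided by the power of \<open>x\<^sub>b\<close> of the same degree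
  is a polynomial in the affine coordinates, and elements of the local ring are quotients of these.\<close>

lemma local_ring_least:
  assumes P: "P \<in> X" and R: "subring_over \<iota> R" and b: "b \<in> {1..N}" "P b \<noteq> 0"
    and gen: "\<And>i. i \<in> {1..N} \<Longrightarrow> dehomogenized \<xi> b i \<in> R"
    and inv: "\<And>f c. f \<in> R \<Longrightarrow> has_value P f c \<Longrightarrow> c \<noteq> 0 \<Longrightarrow> inverse f \<in> R"
    and f: "has_value P f c"
  shows "f \<in> R"
proof -
  obtain d G H where 1: "G \<in> homogeneous N d" "H \<in> homogeneous N d"
    "evp P H \<noteq> 0" "f = ev G / ev H"
    using f unfolding has_value_def by blast
  have xb: "\<xi> b \<noteq> 0" using coordinate_nonzero P b by blast
  have "ev G / \<xi> b ^ d \<in> R" "ev H / \<xi> b ^ d \<in> R"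
    using dehomogenized_form_in_subring[OF R b(1) xb gen] 1 by blast+
  moreover from this have "inverse (ev H / \<xi> b ^ d) \<in> R"
    using inv[OF _ evp_as_value[OF P b 1(2)]] 1(3) b(2) by auto
  ultimately have "ev G / \<xi> b ^ d * inverse (ev H / \<xi> b ^ d) \<in> R"
    using R unfolding subring_over_def by blast
  then show ?thesis using xb by (simp add: 1(4))
qed

text \<open>The analogous principle for the whole function field.\<close>

lemma quotient_of_subring:
  assumes R: "subring_over \<iota> R" and b: "b \<in> {1..N}" "\<xi> b \<noteq> 0"
    and gen: "\<And>i. i \<in> {1..N} \<Longrightarrow> dehomogenized \<xi> b i \<in> R"
  obtains g h where "g \<in> R" "h \<in> R" "h \<noteq> 0" "f = g / h"
proof -
  obtain d G H where GH: "G \<in> homogeneous N d" "H \<in> homogeneous N d" "ev H \<noteq> 0" "f = ev G / ev H"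
    using quotient_of_forms by blast
  show ?thesis
  proof (rule that)
    show "ev G / \<xi> b ^ d \<in> R" "ev H / \<xi> b ^ d \<in> R"
      using dehomogenized_form_in_subring[OF R b gen] GH by blast+
  qed (use GH b in auto)
qed

end

section \<open>Derivations and regular differentials\<close>

lemma derivationD:
  assumes "derivation \<iota> D"
  shows "D (f + g) = D f + D g" "D (f * g) = f * D g + g * D f" "D (\<iota> c) = 0"
  using assms by (auto simp: derivation_def)

lemma derivation_zero: "derivation \<iota> D \<Longrightarrow> D 0 = 0"
  using derivationD(1)[of \<iota> D 0 0] by (metis add.right_neutral add_left_imp_eq)

lemma derivation_one: "derivation \<iota> D \<Longrightarrow> D 1 = 0"
  using derivationD(2)[of \<iota> D 1 1] by (metis add.right_neutral add_left_imp_eq mult_1)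

lemma derivation_inverse:
  assumes "derivation \<iota> D"
  shows "D (inverse f) = - D f * inverse f ^ 2"
proof (cases "f = 0")
  case False
  have "0 = f * D (inverse f) + inverse f * D f"
    using derivationD(2)[OF assms, of f "inverse f"] derivation_one[OF assms] False by simp
  then show ?thesis using False by (simp add: field_simps power2_eq_square eq_neg_iff_add_eq_0)
qed (simp add: derivation_zero[OF assms])

lemma derivation_power:
  assumes "derivation \<iota> D"
  shows "D (f ^ Suc j) = of_nat (Suc j) * f ^ j * D f"
  by (induction j) (simp_all add: derivationD[OF assms] algebra_simps)

text \<open>The functions \<open>f\<close> in the local ring such that \<open>\<theta> D(f)\<close> lies there too form a ring that is
  closed under inverting units, so it suffices to test the affine coordinates.\<close>

lemma (in function_field) derivation_preserves_local_ring:
  assumes D: "derivation \<iota> D" and P: "P \<in> X" and b: "b \<in> {1..N}" "P b \<noteq> 0"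
    and theta: "has_value P \<theta> c0"
    and gen: "\<And>i. i \<in> {1..N} \<Longrightarrow> \<exists>c. has_value P (\<theta> * D (dehomogenized \<xi> b i)) c"
    and f: "has_value P f c"
  shows "\<exists>c. has_value P (\<theta> * D f) c"
proof -
  define R where "R = {f. (\<exists>c. has_value P f c) \<and> (\<exists>c. has_value P (\<theta> * D f) c)}"
  have "f \<in> R"
  proof (rule local_ring_least[OF P _ b _ _ f])
    show "subring_over \<iota> R"
      unfolding subring_over_def
    proof (intro conjI ballI subsetI)
      fix f assume "f \<in> range \<iota>"
      then show "f \<in> R"
        using has_value_const[of P 0] has_value_const[of P]
        by (auto simp: R_def derivationD(3)[OF D])
    next
      fix f g assume "f \<in> R" "g \<in> R"
      then obtain a a' b b' where *: "has_value P f a" "has_value P (\<theta> * D f) a'"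
        "has_value P g b" "has_value P (\<theta> * D g) b'"
        unfolding R_def by blast
      have "\<theta> * D (f + g) = \<theta> * D f + \<theta> * D g" "\<theta> * D (f * g) = f * (\<theta> * D g) + g * (\<theta> * D f)"
        by (simp_all add: derivationD[OF D] algebra_simps)
      then show "f + g \<in> R" "f * g \<in> R"
        using * has_value_add[OF P] has_value_mult unfolding R_def by (auto, (metis)+)
    qed
  next
    show "dehomogenized \<xi> b i \<in> R" if "i \<in> {1..N}" for i
      using has_value_coordinate[OF that b(1), of P] b(2) gen[OF that] by (auto simp: R_def)
  next
    fix f c assume f: "f \<in> R" "has_value P f c" "c \<noteq> 0"
    then obtain a' where "has_value P (\<theta> * D f) a'" by (auto simp: R_def)
    then have "has_value P (- (\<theta> * D f) * inverse f ^ 2) (- a' * inverse c ^ 2)"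
      by (intro has_value_mult has_value_uminus has_value_power has_value_inverse f)
    moreover have "- (\<theta> * D f) * inverse f ^ 2 = \<theta> * D (inverse f)"
      by (simp add: derivation_inverse[OF D])
    ultimately show "inverse f \<in> R"
      using has_value_inverse[OF f(2,3)] by (auto simp: R_def)
  qed
  then show ?thesis by (simp add: R_def)
qed

lemma (in function_field) regular_atI:
  assumes "has_value P f c" "has_value P g c'"
  shows "regular_at N \<iota> \<xi> P (scale_form f (differential \<iota> g))"
proof -
  have "scale_form f (differential \<iota> g) = (\<Sum>i<Suc 0. scale_form f (differential \<iota> g))" by simp
  then show ?thesis
    unfolding regular_at_def local_ring_iff using assms
    by (intro exI[of _ "Suc 0"] exI[of _ "\<lambda>_. f"] exI[of _ "\<lambda>_. g"]) auto
qed

section \<open>The curve\<close>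

locale fermat_function_field =
  function_field "n + 1" "fermat_curve k n l" \<iota> \<xi>
  for n k :: nat and l :: "nat \<Rightarrow> 'a::alg_closed_field" and \<iota> :: "'a \<Rightarrow> 'f::field" and \<xi> +
  assumes char_two: "CHAR('a) = 2"
    and k_ge: "k \<ge> 3" and k_odd: "odd k" and n_ge: "n \<ge> 2"
    and l_nonzero: "\<forall>j\<in>{1..n - 2}. l j \<noteq> 0 \<and> l j \<noteq> 1"
    and l_inj: "inj_on l {1..n - 2}"
begin

\<comment> \<open>The coordinate index \<open>1\<close> has to keep the form in which it occurs in the lemmas.\<close>
declare One_nat_def [simp del]

abbreviation curve :: "(nat \<Rightarrow> 'a) set" where "curve \<equiv> fermat_curve k n l"

text \<open>With the coefficient \<open>1\<close> of the first equation counted as \<open>L 3\<close>, all equations read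
  \<open>x\<^sub>i\<^sup>k = L\<^sub>i x\<^sub>1\<^sup>k + x\<^sub>2\<^sup>k\<close>.\<close>

definition L :: "nat \<Rightarrow> 'a" where "L i = (if i = 3 then 1 else l (i - 3))"

definition I :: "nat set" where "I = {3..n + 1}"

lemma finite_I [simp]: "finite I" by (simp add: I_def)

lemma I_range: "i \<in> I \<Longrightarrow> i \<in> {1..n + 1}" "1 \<notin> I" "2 \<notin> I" "Suc 0 \<notin> I"
  by (auto simp: I_def)

lemma coordinate_cases: "i \<in> {1..n + 1} \<Longrightarrow> i = 1 \<or> i = 2 \<or> i \<in> I"
  by (auto simp: I_def)

lemma L_nonzero:
  assumes "i \<in> I"
  shows "L i \<noteq> 0"
proof (cases "i = 3")
  case False
  then have "i - 3 \<in> {1..n - 2}" using assms by (auto simp: I_def)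
  then show ?thesis using l_nonzero False by (auto simp: L_def)
qed (simp add: L_def)

lemma L_inj:
  assumes "i \<in> I" "j \<in> I" "L i = L j"
  shows "i = j"
proof -
  have r: "a - 3 \<in> {1..n - 2}" if "a \<in> I" "a \<noteq> 3" for a using that by (auto simp: I_def)
  have "l (a - 3) \<noteq> 1" if "a \<in> I" "a \<noteq> 3" for a using l_nonzero r[OF that] by blast
  moreover have "i = j" if "i \<noteq> 3" "j \<noteq> 3"
  proof -
    have "i - 3 = j - 3"
      using inj_onD[OF l_inj _ r r] assms that by (auto simp: L_def)
    then show ?thesis using assms(1,2) by (auto simp: I_def)
  qed
  ultimately show ?thesis using assms by (metis L_def)
qed

lemma char_two_ff: "CHAR('f) = 2"
proof (rule CHAR_eqI)
  show "of_nat 2 = (0 :: 'f)"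
    using const_of_nat[of 2] of_nat_CHAR[where 'a='a] char_two by (metis const_zero)
  show "2 dvd j" if "of_nat j = (0 :: 'f)" for j
    using that const_of_nat[of j] char_two of_nat_eq_0_iff_char_dvd[where 'a='a]
    by (metis const_eq_0_iff)
qed

lemma uminus_eq [simp]: "- (x :: 'a) = x" "- (f :: 'f) = f"
  using uminus_CHAR_2 char_two char_two_ff by blast+

lemma add_self [simp]: "x + x = (0 :: 'a)" "f + f = (0 :: 'f)"
  using add.right_inverse[of x] add.right_inverse[of f] by simp_all

lemma two_eq_zero [simp]: "(2 :: 'a) = 0" "(2 :: 'f) = 0"
  using add_self(1)[of 1] add_self(2)[of 1] by (simp_all only: one_add_one)

lemma square_add: "((f :: 'f) + g)\<^sup>2 = f\<^sup>2 + g\<^sup>2"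
  by (simp add: power2_sum)

lemma of_nat_k: "of_nat k = (1 :: 'a)" "of_nat k = (1 :: 'f)"
proof -
  have "of_nat k = (1 :: 'b::field)" if "CHAR('b) = 2"
  proof -
    obtain m where "k = 2 * m + 1" using k_odd by (elim oddE)
    moreover have "of_nat 2 = (0 :: 'b)" using of_nat_CHAR[where 'a='b] that by simp
    ultimately show ?thesis by (simp only: of_nat_add of_nat_mult mult_zero_left add_0 of_nat_1)
  qed
  then show "of_nat k = (1 :: 'a)" "of_nat k = (1 :: 'f)" using char_two char_two_ff by blast+
qed

lemma curve_iff:
  "P \<in> curve \<longleftrightarrow> P \<in> hcoords (n + 1) \<and> (\<forall>i\<in>I. P i ^ k = L i * P 1 ^ k + P 2 ^ k)"
proof -
  have z: "a + b + c = 0 \<longleftrightarrow> c = a + b" for a b c :: 'a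
    using eq_neg_iff_add_eq_0[of c "a + b"] by (simp add: add_ac)
  have "I = insert 3 ((\<lambda>j. j + 3) ` {1..n - 2})"
  proof -
    have "\<exists>j\<in>{1..n - 2}. i = j + 3" if "i \<in> I" "i \<noteq> 3" for i
      using that by (intro bexI[of _ "i - 3"]) (auto simp: I_def)
    then show ?thesis using n_ge by (auto simp: I_def)
  qed
  then have "(\<forall>i\<in>I. Q i) \<longleftrightarrow> Q 3 \<and> (\<forall>j\<in>{1..n - 2}. Q (j + 3))" for Q
    by (simp only: ball_simps)
  note this[of "\<lambda>i. P i ^ k = L i * P 1 ^ k + P 2 ^ k"]
  then show ?thesis by (simp add: fermat_curve_def z L_def)
qed

definition affine_point :: "'a \<Rightarrow> (nat \<Rightarrow> 'a) \<Rightarrow> nat \<Rightarrow> 'a" where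
  "affine_point t r = (\<lambda>i. if i = 1 then t else if i = 2 then 1 else if i \<in> I then r i else 0)"

definition infinite_point :: "(nat \<Rightarrow> 'a) \<Rightarrow> nat \<Rightarrow> 'a" where
  "infinite_point r = (\<lambda>i. if i = 1 then 1 else if i \<in> I then r i else 0)"

lemma affine_point_simps [simp]:
  "affine_point t r 1 = t" "affine_point t r 2 = 1" "affine_point t r (Suc 0) = t"
  "i \<in> I \<Longrightarrow> affine_point t r i = r i"
  using I_range by (auto simp: affine_point_def)

lemma infinite_point_simps [simp]:
  "infinite_point r 1 = 1" "infinite_point r 2 = 0" "infinite_point r (Suc 0) = 1"
  "i \<in> I \<Longrightarrow> infinite_point r i = r i"
  using I_range by (auto simp: infinite_point_def)

lemma affine_point_in_curve:
  assumes "\<And>i. i \<in> I \<Longrightarrow> r i ^ k = L i * t ^ k + 1"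
  shows "affine_point t r \<in> curve"
proof -
  have "affine_point t r \<in> hcoords (n + 1)"
    using n_ge unfolding hcoords_def
    by (auto simp: affine_point_def I_def intro!: exI[of _ 2])
  then show ?thesis by (simp add: curve_iff assms)
qed

lemma infinite_point_in_curve:
  assumes "\<And>i. i \<in> I \<Longrightarrow> r i ^ k = L i"
  shows "infinite_point r \<in> curve"
proof -
  have "infinite_point r \<in> hcoords (n + 1)"
    using n_ge unfolding hcoords_def
    by (auto simp: infinite_point_def I_def intro!: exI[of _ 1])
  then show ?thesis using k_ge by (simp add: curve_iff assms)
qed

lemma affine_point_exists:
  obtains r where "\<And>i. i \<in> I \<Longrightarrow> r i ^ k = L i * t ^ k + 1" "affine_point t r \<in> curve"
proof -
  have "\<exists>y. y ^ k = L i * t ^ k + 1" for i using nth_root_exists[of k] k_ge by auto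
  then obtain r where "\<And>i. r i ^ k = L i * t ^ k + 1" by metis
  then show ?thesis using that affine_point_in_curve by blast
qed

text \<open>In terms of the \<open>k\<close>-th powers \<open>y\<^sub>1, y\<^sub>2\<close> of the first two coordinates, the \<open>k\<close>-th powers of all
  coordinates are the linear forms \<open>y\<^sub>1\<close>, \<open>y\<^sub>2\<close> and \<open>L\<^sub>i y\<^sub>1 + y\<^sub>2\<close>. These are pairwise independent, so at
  most one coordinate of a point is zero; this lemma and the next one are the two cases that occur below.\<close>

lemma nonzero_coordinates_at_infinity:
  assumes "P \<in> curve" "P 2 = 0"
  shows "P 1 \<noteq> 0" "i \<in> I \<Longrightarrow> P i \<noteq> 0"
proof -
  have eq: "P i ^ k = L i * P 1 ^ k" if "i \<in> I" for i
    using assms k_ge that by (auto simp: curve_iff power_0_left)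
  show 1: "P 1 \<noteq> 0"
  proof
    assume 0: "P 1 = 0"
    have "P i = 0" for i
    proof (cases "i \<in> {1..n + 1}")
      case True
      then show ?thesis using coordinate_cases[OF True] 0 assms(2) eq[of i] k_ge by (auto simp: power_0_left)
    next
      case False
      then show ?thesis using assms(1) by (auto simp: curve_iff hcoords_def)
    qed
    then show False using assms(1) by (auto simp: curve_iff hcoords_def)
  qed
  show "P i \<noteq> 0" if "i \<in> I"
    using eq[OF that] 1 L_nonzero[OF that] k_ge by (auto simp: power_0_left)
qed

lemma nonzero_coordinates_at_ramification:
  assumes P: "P \<in> curve" "P 2 \<noteq> 0" and i: "i \<in> I" "P i = 0"
  shows "P 1 \<noteq> 0" "j \<in> I \<Longrightarrow> j \<noteq> i \<Longrightarrow> P j \<noteq> 0"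
proof -
  have eq: "P i ^ k = L i * P 1 ^ k + P 2 ^ k" if "i \<in> I" for i
    using P that by (auto simp: curve_iff)
  have i0: "L i * P 1 ^ k + P 2 ^ k = 0" using eq[OF i(1)] i(2) k_ge by (simp add: power_0_left)
  show 1: "P 1 \<noteq> 0" using i0 P(2) k_ge by (auto simp: power_0_left)
  show "P j \<noteq> 0" if j: "j \<in> I" "j \<noteq> i"
  proof
    assume "P j = 0"
    then have "L j * P 1 ^ k + P 2 ^ k = 0" using eq[OF j(1)] k_ge by (simp add: power_0_left)
    with i0 have "L j * P 1 ^ k = L i * P 1 ^ k" by (metis add_right_cancel)
    then show False using 1 L_inj j i by auto
  qed
qed

section \<open>Coordinate functions\<close>

abbreviation Y :: "nat \<Rightarrow> 'f" where "Y \<equiv> dehomogenized \<xi> 2"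
abbreviation Z :: "nat \<Rightarrow> 'f" where "Z \<equiv> dehomogenized \<xi> 1"
abbreviation T :: 'f where "T \<equiv> Y 1"

lemma mem12 [simp]: "1 \<in> {1..n + 1}" "2 \<in> {1..n + 1}" using n_ge by auto

lemma xi_nonzero: "\<xi> 1 \<noteq> 0" "\<xi> 2 \<noteq> 0" "i \<in> I \<Longrightarrow> \<xi> i \<noteq> 0"
proof -
  obtain r where r: "affine_point 1 r \<in> curve" using affine_point_exists by blast
  show "\<xi> 1 \<noteq> 0" "\<xi> 2 \<noteq> 0"
    using coordinate_nonzero[OF mem12(1) r] coordinate_nonzero[OF mem12(2) r] by simp_all
  obtain r where r: "\<And>i. i \<in> I \<Longrightarrow> r i ^ k = L i * 0 ^ k + 1" "affine_point 0 r \<in> curve"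
    using affine_point_exists by blast
  show "\<xi> i \<noteq> 0" if i: "i \<in> I"
  proof -
    have "r i ^ k \<noteq> 0" using r(1)[OF i] k_ge by (simp add: power_0_left)
    then have "r i \<noteq> 0" using k_ge by (auto simp: power_0_left)
    then show ?thesis using coordinate_nonzero[OF I_range(1)[OF i] r(2)] i by simp
  qed
qed

lemma Y2 [simp]: "Y 2 = 1" and Z1: "Z 1 = 1"
  using xi_nonzero by (simp_all add: dehomogenized_def)

lemma T_nonzero: "T \<noteq> 0" and Y_nonzero: "i \<in> I \<Longrightarrow> Y i \<noteq> 0"
  and Z2: "Z 2 = inverse T" and Y_eq: "Y i = T * Z i"
  using xi_nonzero by (simp_all add: dehomogenized_def)

lemma value_Y: "P 2 \<noteq> 0 \<Longrightarrow> i \<in> {1..n + 1} \<Longrightarrow> has_value P (Y i) (P i / P 2)"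
  and value_Z: "P 1 \<noteq> 0 \<Longrightarrow> i \<in> {1..n + 1} \<Longrightarrow> has_value P (Z i) (P i / P 1)"
  using has_value_coordinate mem12 by blast+

text \<open>The equation holds at all points of the affine part, hence at the generic point.\<close>

lemma curve_equation:
  assumes "i \<in> I"
  shows "Y i ^ k = \<iota> (L i) * T ^ k + 1"
proof -
  have "Y i ^ k - (\<iota> (L i) * T ^ k + 1) = 0"
  proof (rule zero_if_values_zero[OF mem12(2) xi_nonzero(2)])
    fix P assume P: "P \<in> curve" "P 2 \<noteq> 0"
    have "has_value P (Y i ^ k - (\<iota> (L i) * T ^ k + \<iota> 1)) ((P i / P 2) ^ k - (L i * (P 1 / P 2) ^ k + 1))"
      using P I_range(1)[OF assms]
      by (intro has_value_diff has_value_add has_value_mult has_value_power has_value_const value_Y) auto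
    moreover have "(P i / P 2) ^ k = L i * (P 1 / P 2) ^ k + 1"
      using P assms by (simp add: curve_iff power_divide add_divide_distrib)
    ultimately show "has_value P (Y i ^ k - (\<iota> (L i) * T ^ k + 1)) 0" by (simp add: const_one)
  qed
  then show ?thesis by simp
qed

lemma curve_equation_at_infinity:
  assumes "i \<in> I"
  shows "Z i ^ k = \<iota> (L i) + Z 2 ^ k"
proof -
  have "T ^ k * Z i ^ k = \<iota> (L i) * T ^ k + (T * Z 2) ^ k"
    using curve_equation[OF assms] Y_eq[of i] Z2 T_nonzero by (simp add: power_mult_distrib)
  also have "\<dots> = T ^ k * (\<iota> (L i) + Z 2 ^ k)" by (simp add: power_mult_distrib algebra_simps)
  finally show ?thesis using T_nonzero by simp
qed

section \<open>Expansions in the monomials \<open>Y\<^sup>e\<close>\<close>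

definition pT :: "'a poly \<Rightarrow> 'f" where "pT p = poly (map_poly \<iota> p) T"

lemma pT_simps [simp]:
  "pT 0 = 0" "pT (pCons a p) = \<iota> a + T * pT p"
  by (auto simp: pT_def map_poly_pCons)

lemma pT_add: "pT (p + q) = pT p + pT q"
proof -
  have "map_poly \<iota> (p + q) = map_poly \<iota> p + map_poly \<iota> q"
    by (rule poly_eqI) (simp add: coeff_map_poly const_add)
  then show ?thesis by (simp add: pT_def)
qed

lemma pT_smult: "pT (smult c p) = \<iota> c * pT p"
proof -
  have "map_poly \<iota> (smult c p) = smult (\<iota> c) (map_poly \<iota> p)"
    by (rule poly_eqI) (simp add: coeff_map_poly const_mult)
  then show ?thesis by (simp add: pT_def)
qed

lemma pT_mult: "pT (p * q) = pT p * pT q"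
  by (induction p) (simp_all add: pT_add pT_smult algebra_simps)

lemma pT_monom: "pT (monom c j) = \<iota> c * T ^ j"
  by (induction j) (simp_all add: monom_0 monom_Suc)

lemma pT_sum: "pT (sum p A) = (\<Sum>i\<in>A. pT (p i))"
  by (induction A rule: infinite_finite_induct) (simp_all add: pT_add)

lemma pT_altdef:
  assumes "degree p \<le> M"
  shows "pT p = (\<Sum>j\<le>M. \<iota> (coeff p j) * T ^ j)"
  by (subst poly_as_sum_of_monoms'[OF assms, symmetric]) (simp add: pT_sum pT_monom)

lemma value_pT:
  assumes P: "P \<in> curve" "P 2 \<noteq> 0"
  shows "has_value P (pT p) (poly p (P 1 / P 2))"
proof (induction p)
  case 0
  then show ?case using has_value_const[of P 0] by simp
next
  case (pCons a p)
  have "has_value P (\<iota> a + T * pT p) (a + P 1 / P 2 * poly p (P 1 / P 2))"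
    by (intro has_value_add[OF P(1)] has_value_mult has_value_const value_Y P(2) mem12 pCons.IH)
  then show ?case by simp
qed

text \<open>The exponents that remain after reduction by \<open>Y\<^sub>i\<^sup>k = L\<^sub>i T\<^sup>k + 1\<close>.\<close>

definition Box :: "(nat \<Rightarrow> nat) set" where "Box = Pi\<^sub>E I (\<lambda>_. {..<k})"

lemma finite_Box [simp]: "finite Box" by (simp add: Box_def finite_PiE)

definition mon :: "(nat \<Rightarrow> nat) \<Rightarrow> 'f" where "mon e = (\<Prod>i\<in>I. Y i ^ e i)"

definition comb :: "((nat \<Rightarrow> nat) \<Rightarrow> 'a poly) \<Rightarrow> 'f" where
  "comb p = (\<Sum>e\<in>Box. pT (p e) * mon e)"

text \<open>The sum has value zero at all points over \<open>t\<close>. There the vector of the values of the \<open>Y\<^sub>i\<close> runs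
  through a full grid of \<open>k\<close>-th roots, so \<open>vanishing_on_grid\<close> applies.\<close>

lemma coefficients_vanish_unramified:
  assumes q: "\<And>P. P \<in> curve \<Longrightarrow> P 2 = 1 \<Longrightarrow> P 1 = t \<Longrightarrow> \<exists>c. has_value P q c"
    and eq: "comb p = (T - \<iota> t) * q"
    and ur: "\<And>i. i \<in> I \<Longrightarrow> L i * t ^ k + 1 \<noteq> 0"
    and e: "e \<in> Box"
  shows "poly (p e) t = 0"
proof (rule vanishing_on_grid[where I=I and k=k and S="\<lambda>i. {r. r ^ k = L i * t ^ k + 1}"
      and c="\<lambda>e. poly (p e) t"])
  show "k \<le> card {r. r ^ k = L i * t ^ k + 1}" if "i \<in> I" for i
    using card_kth_roots[OF ur[OF that], of k] k_ge of_nat_k by simp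
next
  fix r assume "r \<in> Pi\<^sub>E I (\<lambda>i. {r. r ^ k = L i * t ^ k + 1})"
  then have r: "\<And>i. i \<in> I \<Longrightarrow> r i ^ k = L i * t ^ k + 1" by auto
  define P where "P = affine_point t r"
  have P: "P \<in> curve" "P 1 = t" "P 2 = 1" "\<And>i. i \<in> I \<Longrightarrow> P i = r i"
    using affine_point_in_curve[OF r] by (simp_all add: P_def)
  have vY: "has_value P (Y i) (r i)" if "i \<in> I" for i
    using value_Y[of P i] P that I_range by auto
  have vp: "has_value P (pT p) (poly p t)" for p using value_pT[of P p] P by simp
  have "has_value P (comb p) (\<Sum>e\<in>Box. poly (p e) t * (\<Prod>i\<in>I. r i ^ e i))"
    unfolding comb_def mon_def
    by (intro has_value_sum[OF P(1)] has_value_mult vp has_value_prod has_value_power vY)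
  moreover obtain c where "has_value P q c" using q[of P] P by blast
  then have "has_value P ((T - \<iota> t) * q) ((t - t) * c)"
    using P value_Y[of P 1]
    by (intro has_value_mult has_value_diff[OF P(1)] has_value_const) auto
  ultimately show "(\<Sum>e\<in>Pi\<^sub>E I (\<lambda>_. {..<k}). poly (p e) t * (\<Prod>i\<in>I. r i ^ e i)) = 0"
    using has_value_unique[OF P(1)] eq by (simp add: Box_def)
qed (use e in \<open>auto simp: Box_def\<close>)

text \<open>Over a zero \<open>t\<close> of \<open>L\<^sub>a x\<^sup>k + 1\<close> the coordinate \<open>Y\<^sub>a\<close> vanishes, the others still run through a
  grid, and \<open>Y\<^sub>a\<^sup>k = (T - t) U(T)\<close> with \<open>U(t) \<noteq> 0\<close>. Induction on the exponent \<open>j\<close> of \<open>Y\<^sub>a\<close>: once the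
  coefficients with smaller exponent are known to vanish at \<open>t\<close>, they can be moved to the right-hand
  side; what remains is divisible by \<open>Y\<^sub>a\<^sup>j\<close>, and after division the right-hand side still contains
  the factor \<open>Y\<^sub>a\<^bsup>k-j\<^esup>\<close>, so that taking values leaves exactly the terms with exponent \<open>j\<close>.\<close>

lemma coefficients_vanish_ramified:
  assumes q: "\<And>P. P \<in> curve \<Longrightarrow> P 2 = 1 \<Longrightarrow> P 1 = t \<Longrightarrow> \<exists>c. has_value P q c"
    and eq: "comb p = (T - \<iota> t) * q"
    and a: "a \<in> I" "L a * t ^ k + 1 = 0"
    and e: "e \<in> Box"
  shows "poly (p e) t = 0"
  using e
proof (induction "e a" arbitrary: e rule: less_induct)
  case less
  define j where "j = e a"
  have j: "j < k" using less.prems a(1) by (auto simp: j_def Box_def)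
  have t: "t \<noteq> 0" using a(2) k_ge by (auto simp: power_0_left)
  have ur: "L i * t ^ k + 1 \<noteq> 0" if "i \<in> I" "i \<noteq> a" for i
  proof
    assume "L i * t ^ k + 1 = 0"
    with a(2) have "L i * t ^ k = L a * t ^ k" by (metis add_right_cancel)
    with t have "L i = L a" by simp
    then show False using L_inj that a(1) by blast
  qed
  define J where "J = I - {a}"
  have J: "I = insert a J" "a \<notin> J" "finite J" using a(1) by (auto simp: J_def)
  define monJ where "monJ e = (\<Prod>i\<in>J. Y i ^ e i)" for e :: "nat \<Rightarrow> nat"
  have mon: "mon e = Y a ^ e a * monJ e" for e
    unfolding mon_def monJ_def using J by simp

  \<comment> \<open>\<open>U(t)\<close> is the derivative of \<open>L\<^sub>a x\<^sup>k + 1\<close> at \<open>t\<close>, nonzero since \<open>k\<close> is odd.\<close>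
  obtain U where U: "[:1:] + monom (L a) k = [:- t, 1:] * U"
  proof -
    have "poly ([:1:] + monom (L a) k) t = 0" using a(2) by (simp add: poly_monom add.commute)
    then show ?thesis using that by (metis poly_eq_0_iff_dvd dvdE)
  qed
  have Ut: "poly U t \<noteq> 0"
  proof -
    have "poly (pderiv ([:1:] + monom (L a) k)) t = L a * t ^ (k - 1)"
      using of_nat_k by (simp add: pderiv_add pderiv_monom poly_monom pderiv_pCons)
    moreover have "poly (pderiv ([:- t, 1:] * U)) t = poly U t"
      by (simp only: pderiv_mult) (simp add: pderiv_pCons)
    ultimately show ?thesis using U t L_nonzero[OF a(1)] by auto
  qed
  have Yk: "Y a ^ k = (T - \<iota> t) * pT U"
  proof -
    have "Y a ^ k = pT ([:1:] + monom (L a) k)"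
      using curve_equation[OF a(1)] by (simp add: pT_add pT_monom const_one add.commute)
    also have "\<dots> = (T - \<iota> t) * pT U"
      unfolding U pT_mult by (simp add: const_one const_uminus)
    finally show ?thesis .
  qed

  define p' where "p' f = p f div [:- t, 1:]" for f
  have p': "pT (p f) = (T - \<iota> t) * pT (p' f)" if "f \<in> Box" "f a < j" for f
  proof -
    have "[:- t, 1:] dvd p f"
      using less.hyps[of f] that by (simp add: j_def poly_eq_0_iff_dvd)
    then have "p f = [:- t, 1:] * p' f" by (simp only: p'_def dvd_mult_div_cancel)
    then have "pT (p f) = pT ([:- t, 1:] * p' f)" by simp
    then show ?thesis unfolding pT_mult by (simp add: const_one const_uminus)
  qed
  define lo where "lo = {f\<in>Box. f a < j}"
  define hi where "hi = {f\<in>Box. \<not> f a < j}"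
  have lohi: "Box = lo \<union> hi" "lo \<inter> hi = {}" "finite lo" "finite hi"
    by (auto simp: lo_def hi_def)
  define q' where "q' = q - (\<Sum>f\<in>lo. pT (p' f) * mon f)"
  have "(\<Sum>f\<in>lo. pT (p f) * mon f) + (\<Sum>f\<in>hi. pT (p f) * mon f) = (T - \<iota> t) * q"
    using eq unfolding comb_def lohi(1) sum.union_disjoint[OF lohi(3,4,2)] .
  moreover have "(\<Sum>f\<in>lo. pT (p f) * mon f) = (T - \<iota> t) * (\<Sum>f\<in>lo. pT (p' f) * mon f)"
    unfolding sum_distrib_left by (rule sum.cong) (auto simp: lo_def p')
  moreover have "H = B * q - B * S" if "G + H = B * q" "G = B * S" for G H B S :: 'f
    using that by (metis add_diff_cancel_left')
  ultimately have "(\<Sum>f\<in>hi. pT (p f) * mon f) = (T - \<iota> t) * q'"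
    unfolding q'_def right_diff_distrib[of "T - \<iota> t"] by blast
  then have "pT U * (\<Sum>f\<in>hi. pT (p f) * mon f) = Y a ^ k * q'"
    unfolding Yk by (simp add: mult_ac)
  also have "Y a ^ k = Y a ^ j * Y a ^ (k - j)" using j by (simp flip: power_add)
  also have "(\<Sum>f\<in>hi. pT (p f) * mon f) =
      Y a ^ j * (\<Sum>f\<in>hi. pT (p f) * (Y a ^ (f a - j) * monJ f))"
    unfolding sum_distrib_left
  proof (rule sum.cong[OF refl])
    fix f assume "f \<in> hi"
    then have "Y a ^ f a = Y a ^ j * Y a ^ (f a - j)" by (simp add: hi_def flip: power_add)
    then show "pT (p f) * mon f = Y a ^ j * (pT (p f) * (Y a ^ (f a - j) * monJ f))"
      by (simp add: mon mult_ac)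
  qed
  finally have main: "pT U * (\<Sum>f\<in>hi. pT (p f) * (Y a ^ (f a - j) * monJ f)) = Y a ^ (k - j) * q'"
    using Y_nonzero[OF a(1)] by (simp add: mult_ac)

  have "poly (p (g(a := j))) t = 0" if g: "g \<in> Pi\<^sub>E J (\<lambda>_. {..<k})" for g
  proof (rule vanishing_on_grid[where I=J and k=k and S="\<lambda>i. {r. r ^ k = L i * t ^ k + 1}"
        and c="\<lambda>g. poly (p (g(a := j))) t"])
    show "k \<le> card {r. r ^ k = L i * t ^ k + 1}" if "i \<in> J" for i
      using card_kth_roots[OF ur, of i k] k_ge of_nat_k that by (simp add: J_def)
  next
    fix r assume "r \<in> Pi\<^sub>E J (\<lambda>i. {r. r ^ k = L i * t ^ k + 1})"
    then have r: "\<And>i. i \<in> J \<Longrightarrow> r i ^ k = L i * t ^ k + 1" by auto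
    define P where "P = affine_point t (r(a := 0))"
    have "P \<in> curve"
      unfolding P_def by (rule affine_point_in_curve) (use r J a k_ge in \<open>auto simp: power_0_left\<close>)
    then have P: "P \<in> curve" "P 1 = t" "P 2 = 1" "P a = 0" "\<And>i. i \<in> J \<Longrightarrow> P i = r i"
      using a(1) J(2) by (auto simp: P_def J(1))
    have vY: "has_value P (Y i) (r i)" if "i \<in> J" for i
      using value_Y[of P i] P that I_range J by auto
    have vYa: "has_value P (Y a) 0"
      using value_Y[of P a] P a I_range by auto
    have vp: "has_value P (pT p) (poly p t)" for p using value_pT[of P p] P by simp
    have vmJ: "has_value P (monJ f) (\<Prod>i\<in>J. r i ^ f i)" for f
      unfolding monJ_def by (intro has_value_prod has_value_power vY)
    obtain c where c: "has_value P q c" using q[of P] P by blast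
    have v1: "has_value P (pT U * (\<Sum>f\<in>hi. pT (p f) * (Y a ^ (f a - j) * monJ f)))
        (poly U t * (\<Sum>f\<in>hi. poly (p f) t * (0 ^ (f a - j) * (\<Prod>i\<in>J. r i ^ f i))))"
      by (intro has_value_mult has_value_sum[OF P(1)] has_value_power vYa vp vmJ)
    have v2: "has_value P (Y a ^ (k - j) * q')
        (0 ^ (k - j) * (c - (\<Sum>f\<in>lo. poly (p' f) t * (0 ^ f a * (\<Prod>i\<in>J. r i ^ f i)))))"
      unfolding q'_def mon
      by (intro has_value_mult has_value_diff[OF P(1)] has_value_sum[OF P(1)] has_value_power vYa vp vmJ c)
    have zero: "(0 :: 'a) ^ (k - j) = 0" using j by (simp add: power_0_left)
    have "poly U t * (\<Sum>f\<in>hi. poly (p f) t * (0 ^ (f a - j) * (\<Prod>i\<in>J. r i ^ f i))) = 0"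
      using has_value_unique[OF P(1) v1[unfolded main] v2] unfolding zero mult_zero_left .
    with Ut have "0 = (\<Sum>f\<in>hi. poly (p f) t * (0 ^ (f a - j) * (\<Prod>i\<in>J. r i ^ f i)))" by simp
    also have "\<dots> = (\<Sum>f\<in>Box. if f a = j then poly (p f) t * (\<Prod>i\<in>J. r i ^ f i) else 0)"
      by (rule sum.mono_neutral_cong_left) (auto simp: hi_def power_0_left)
    also have "\<dots> = (\<Sum>i<k. \<Sum>g\<in>Pi\<^sub>E J (\<lambda>_. {..<k}).
        if i = j then poly (p (g(a := i))) t * (\<Prod>i'\<in>J. r i' ^ (g(a := i)) i') else 0)"
      unfolding Box_def J(1) by (subst sum_PiE_insert[OF J(2)]) simp
    also have "\<dots> = (\<Sum>i<k. if i = j then \<Sum>g\<in>Pi\<^sub>E J (\<lambda>_. {..<k}).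
        poly (p (g(a := j))) t * (\<Prod>i'\<in>J. r i' ^ g i') else 0)"
    proof (intro sum.cong refl, goal_cases)
      case (1 i)
      have "(\<Prod>i'\<in>J. r i' ^ (g(a := j)) i') = (\<Prod>i'\<in>J. r i' ^ g i')" for g :: "nat \<Rightarrow> nat"
        by (rule prod.cong) (use J in auto)
      then show ?case by simp
    qed
    also have "\<dots> = (\<Sum>g\<in>Pi\<^sub>E J (\<lambda>_. {..<k}). poly (p (g(a := j))) t * (\<Prod>i'\<in>J. r i' ^ g i'))"
      using j by simp
    finally show "(\<Sum>g\<in>Pi\<^sub>E J (\<lambda>_. {..<k}). poly (p (g(a := j))) t * (\<Prod>i'\<in>J. r i' ^ g i')) = 0" by simp
  qed (use g J in auto)
  from this[of "restrict e J"] have "poly (p ((restrict e J)(a := j))) t = 0"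
    using less.prems J by (auto simp: Box_def)
  moreover have "(restrict e J)(a := j) = e"
    using less.prems J by (auto simp: Box_def j_def fun_eq_iff PiE_iff extensional_def restrict_def)
  ultimately show ?case by simp
qed

lemma coefficients_vanish:
  assumes "\<And>P. P \<in> curve \<Longrightarrow> P 2 = 1 \<Longrightarrow> P 1 = t \<Longrightarrow> \<exists>c. has_value P q c"
    and "comb p = (T - \<iota> t) * q" and "e \<in> Box"
  shows "poly (p e) t = 0"
  using coefficients_vanish_unramified[OF assms(1,2) _ assms(3)]
    coefficients_vanish_ramified[OF assms(1,2) _ _ assms(3)] by blast

text \<open>If \<open>p\<close> were not constant, then \<open>p + 1\<close> would have a root.\<close>

lemma poly_zero_if_everywhere_zero:
  fixes p :: "'a poly"
  assumes "\<And>t. poly p t = 0"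
  shows "p = 0"
proof (cases "degree p = 0")
  case True
  then obtain c where "p = [:c:]" by (elim degree_eq_zeroE)
  then show ?thesis using assms[of 0] by simp
next
  case False
  then have "degree (p + [:1:]) > 0" by (subst degree_add_eq_left) auto
  then obtain t where "poly (p + [:1:]) t = 0" using alg_closed_imp_poly_has_root by blast
  then show ?thesis using assms[of t] by simp
qed

text \<open>Zero is divisible by \<open>T - t\<close> for every \<open>t\<close>.\<close>

lemma comb_eq_zero:
  assumes "comb p = 0" "e \<in> Box"
  shows "p e = 0"
proof (rule poly_zero_if_everywhere_zero)
  fix t
  have "\<exists>c. has_value P 0 c" for P using has_value_const[of P 0] by auto
  then show "poly (p e) t = 0"
    using coefficients_vanish[of t 0 p e] assms by simp
qed

section \<open>Functions regular on the affine part\<close>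

sublocale F: vector_space "\<lambda>c f. \<iota> c * f"
  by unfold_locales (simp_all add: const_one const_add const_mult algebra_simps)

definition gens :: "nat \<Rightarrow> 'f set" where
  "gens M = (\<lambda>(j, e). T ^ j * mon e) ` ({..M} \<times> Box)"

text \<open>Combinations of the \<open>Y\<^sup>e\<close> with polynomials in \<open>T\<close> of degree at most \<open>M\<close> as coefficients.\<close>

definition V :: "nat \<Rightarrow> 'f set" where "V M = F.span (gens M)"

lemma finite_gens [simp]: "finite (gens M)" by (simp add: gens_def)

lemma in_V: "j \<le> M \<Longrightarrow> e \<in> Box \<Longrightarrow> T ^ j * mon e \<in> V M"
  unfolding V_def gens_def by (rule F.span_base) force

lemma V_add: "f \<in> V M \<Longrightarrow> g \<in> V M \<Longrightarrow> f + g \<in> V M"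
  and V_scale: "f \<in> V M \<Longrightarrow> \<iota> c * f \<in> V M"
  and V_zero: "0 \<in> V M"
  and V_sum: "(\<And>i. i \<in> A \<Longrightarrow> h i \<in> V M) \<Longrightarrow> sum h A \<in> V M"
  unfolding V_def by (auto intro: F.span_add F.span_scale F.span_zero F.span_sum)

lemma V_mono: "M \<le> M' \<Longrightarrow> V M \<subseteq> V M'"
  unfolding V_def gens_def by (intro F.span_mono image_mono) auto

lemma comb_in_V:
  assumes "\<And>e j. e \<in> Box \<Longrightarrow> M < j \<Longrightarrow> coeff (p e) j = 0"
  shows "comb p \<in> V M"
  unfolding comb_def
proof (rule V_sum)
  fix e assume e: "e \<in> Box"
  have "degree (p e) \<le> M" using assms[OF e] by (intro degree_le) auto
  then have "pT (p e) * mon e = (\<Sum>j\<le>M. \<iota> (coeff (p e) j) * (T ^ j * mon e))"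
    by (simp add: pT_altdef sum_distrib_right mult.assoc)
  also have "\<dots> \<in> V M" by (intro V_sum V_scale in_V e) auto
  finally show "pT (p e) * mon e \<in> V M" .
qed

lemma comb_add: "comb (\<lambda>e. p e + q e) = comb p + comb q"
  by (simp add: comb_def pT_add algebra_simps sum.distrib)

lemma comb_mult: "comb (\<lambda>e. r * p e) = pT r * comb p"
  by (simp add: comb_def pT_mult sum_distrib_left mult.assoc)

lemma comb_single: "e \<in> Box \<Longrightarrow> comb (\<lambda>f. if f = e then r else 0) = pT r * mon e"
  unfolding comb_def by (subst sum.remove[of _ e]) auto

lemma V_imp_comb:
  assumes "f \<in> V M"
  obtains p where "f = comb p"
proof -
  have "\<exists>p. f = comb p"
    using assms unfolding V_def
  proof (induction rule: F.span_induct_alt)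
    case base
    have "0 = comb (\<lambda>e. 0)" by (simp add: comb_def)
    then show ?case by blast
  next
    case (step c f g)
    then obtain p where p: "g = comb p" by blast
    obtain j e where f: "e \<in> Box" "f = T ^ j * mon e" using step.hyps by (auto simp: gens_def)
    have "\<iota> c * f = comb (\<lambda>e'. if e' = e then monom c j else 0)"
      using comb_single[OF f(1), of "monom c j"] by (simp add: f(2) pT_monom mult.assoc)
    then have "\<iota> c * f + g = comb (\<lambda>e'. (if e' = e then monom c j else 0) + p e')"
      unfolding comb_add p by simp
    then show ?case by blast
  qed
  then show ?thesis using that by blast
qed

lemma monomials_independent:
  assumes "finite A" "A \<subseteq> UNIV \<times> Box" "(\<Sum>(j, e)\<in>A. \<iota> (c (j, e)) * (T ^ j * mon e)) = 0" "(j, e) \<in> A"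
  shows "c (j, e) = 0"
proof -
  define p where "p e' = (\<Sum>x\<in>A. if snd x = e' then monom (c x) (fst x) else 0)" for e'
  have "comb p = (\<Sum>x\<in>A. \<Sum>e'\<in>Box. (if snd x = e' then \<iota> (c x) * T ^ fst x * mon e' else 0))"
    unfolding comb_def p_def pT_sum sum_distrib_right
    by (subst sum.swap) (auto intro!: sum.cong simp: pT_monom)
  also have "\<dots> = (\<Sum>x\<in>A. \<iota> (c x) * T ^ fst x * mon (snd x))"
    using assms(2) by (intro sum.cong refl) (auto simp: sum.delta)
  also have "\<dots> = 0" using assms(3) by (simp add: case_prod_unfold mult.assoc)
  finally have "p e = 0" using comb_eq_zero assms(2,4) by blast
  then have "0 = coeff (p e) j" by simp
  also have "\<dots> = (\<Sum>x\<in>A. if x = (j, e) then c x else 0)"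
    unfolding p_def coeff_sum by (rule sum.cong) (auto simp: prod_eq_iff)
  also have "\<dots> = c (j, e)" using assms(1,4) by simp
  finally show ?thesis by simp
qed

text \<open>This is the ring generated by the affine coordinates, that is, the union of all \<open>V M\<close>. The
  description as the ring of multipliers that raise the degree by a bounded amount makes closure
  under multiplication immediate and provides the bound needed in \<open>multiple_in_base\<close>.\<close>

definition affine_ring :: "'f set" where "affine_ring = {a. \<exists>d. \<forall>M. \<forall>f\<in>V M. a * f \<in> V (M + d)}"

lemma mult_V_if_mult_gens:
  assumes "\<And>j e. e \<in> Box \<Longrightarrow> a * (T ^ j * mon e) \<in> V (j + d)"
  shows "a \<in> affine_ring"
  unfolding affine_ring_def mem_Collect_eq
proof (intro exI allI ballI)
  fix M f assume "f \<in> V M"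
  then show "a * f \<in> V (M + d)"
    unfolding V_def[of M]
  proof (induction rule: F.span_induct_alt)
    case (step c f g)
    then obtain j e where "e \<in> Box" "j \<le> M" "f = T ^ j * mon e" by (auto simp: gens_def)
    then have "a * f \<in> V (M + d)" using assms V_mono[of "j + d" "M + d"] by auto
    then have "\<iota> c * (a * f) + a * g \<in> V (M + d)" by (intro V_add V_scale step.IH)
    then show ?case by (simp add: algebra_simps)
  qed (simp add: V_zero)
qed

lemma affine_ring_subring: "subring_over \<iota> affine_ring"
  unfolding subring_over_def
proof (intro conjI subsetI ballI)
  fix f assume "f \<in> range \<iota>"
  then show "f \<in> affine_ring" unfolding affine_ring_def using V_scale by (auto intro!: exI[of _ 0])
next
  fix a b assume "a \<in> affine_ring" "b \<in> affine_ring"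
  then obtain c d where c: "\<And>M f. f \<in> V M \<Longrightarrow> a * f \<in> V (M + c)"
    and d: "\<And>M f. f \<in> V M \<Longrightarrow> b * f \<in> V (M + d)" unfolding affine_ring_def by blast
  have "(a + b) * f \<in> V (M + (c + d))" if f: "f \<in> V M" for f M
    using c[OF f] d[OF f] V_mono[of "M + c" "M + (c + d)"] V_mono[of "M + d" "M + (c + d)"]
    by (auto simp: distrib_right intro!: V_add)
  then show "a + b \<in> affine_ring" unfolding affine_ring_def by blast
  have "(a * b) * f \<in> V (M + (d + c))" if f: "f \<in> V M" for f M
    using c[OF d[OF f]] by (simp add: mult.assoc add.assoc)
  then show "a * b \<in> affine_ring" unfolding affine_ring_def by blast
qed

text \<open>Multiplication by \<open>Y\<^sub>i\<close> raises an exponent by one; if that exponent becomes \<open>k\<close>, the curve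
  equation replaces \<open>Y\<^sub>i\<^sup>k\<close> by a polynomial of degree \<open>k\<close> in \<open>T\<close>.\<close>

lemma coordinates_in_affine_ring:
  assumes "i \<in> {1..n + 1}"
  shows "Y i \<in> affine_ring"
proof -
  consider "i = 1" | "i = 2" | "i \<in> I" using coordinate_cases[OF assms] by blast
  then show ?thesis
  proof cases
    case 1
    show ?thesis
    proof (rule mult_V_if_mult_gens)
      fix j e assume "e \<in> Box"
      then show "Y i * (T ^ j * mon e) \<in> V (j + 1)"
        using in_V[of "j + 1" "j + 1" e] 1 by (simp add: power_add mult_ac)
    qed
  next
    case 2
    then show ?thesis using subring_overD(1)[OF affine_ring_subring, of 1] by (simp add: const_one)
  next
    case 3
    show ?thesis
    proof (rule mult_V_if_mult_gens)
      fix j e assume e: "e \<in> Box"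
      have mon_upd: "mon (e(i := x)) = Y i ^ x * (\<Prod>i'\<in>I - {i}. Y i' ^ e i')" for x
      proof -
        have "mon (e(i := x)) = Y i ^ x * (\<Prod>i'\<in>I - {i}. Y i' ^ (e(i := x)) i')"
          unfolding mon_def using 3 by (subst prod.remove[of _ i]) auto
        also have "(\<Prod>i'\<in>I - {i}. Y i' ^ (e(i := x)) i') = (\<Prod>i'\<in>I - {i}. Y i' ^ e i')"
          by (rule prod.cong) auto
        finally show ?thesis .
      qed
      have upd: "e(i := x) \<in> Box" if "x < k" for x
        using e 3 that by (auto simp: Box_def PiE_iff extensional_def)
      have "mon e = mon (e(i := e i))" by simp
      then have step: "Y i * mon e = Y i ^ (e i + 1) * (\<Prod>i'\<in>I - {i}. Y i' ^ e i')"
        unfolding mon_upd by (simp add: power_add mult_ac)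
      show "Y i * (T ^ j * mon e) \<in> V (j + k)"
      proof (cases "e i + 1 < k")
        case True
        have "Y i * (T ^ j * mon e) = T ^ j * mon (e(i := e i + 1))"
          using step by (simp add: mon_upd mult_ac)
        also have "\<dots> \<in> V (j + k)" by (intro in_V upd[OF True]) simp
        finally show ?thesis .
      next
        case False
        then have "e i + 1 = k" using e 3 by (auto simp: Box_def PiE_iff)
        then have "Y i * mon e = (\<iota> (L i) * T ^ k + 1) * mon (e(i := 0))"
          using step curve_equation[OF 3] by (simp add: mon_upd)
        then have "T ^ j * (Y i * mon e) = \<iota> (L i) * (T ^ (j + k) * mon (e(i := 0))) + T ^ j * mon (e(i := 0))"
          by (simp add: algebra_simps power_add)
        also have "\<dots> \<in> V (j + k)"
          using k_ge by (intro V_add V_scale in_V upd) auto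
        finally show ?thesis by (simp only: mult.left_commute)
      qed
    qed
  qed
qed

definition zero_exponent :: "nat \<Rightarrow> nat" where "zero_exponent = restrict (\<lambda>_. 0) I"

lemma zero_exponent_in_Box: "zero_exponent \<in> Box"
  using k_ge by (auto simp: zero_exponent_def Box_def)

lemma mon_zero_exponent: "mon zero_exponent = 1"
  by (simp add: mon_def zero_exponent_def)

lemma power_T_in_V: "j \<le> M \<Longrightarrow> T ^ j \<in> V M"
  using in_V[OF _ zero_exponent_in_Box, of j M] by (simp add: mon_zero_exponent)

text \<open>A dimension count: multiplication by \<open>a\<close> embeds \<open>V M\<close> into \<open>V (M + d)\<close>, whose dimension
  exceeds that of \<open>V M\<close> by \<open>d\<close> times the number of monomials \<open>Y\<^sup>e\<close>. For \<open>M\<close> large, \<open>a V M\<close>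
  therefore has a nonzero element in common with the space of polynomials in \<open>T\<close> of degree at
  most \<open>M + d\<close>.\<close>

lemma multiple_in_base:
  assumes a: "a \<in> affine_ring" "a \<noteq> 0"
  obtains r b M where "r \<noteq> 0" "b \<in> V M" "a * b = pT r"
proof -
  obtain d where d: "\<And>M f. f \<in> V M \<Longrightarrow> a * f \<in> V (M + d)" using a(1) unfolding affine_ring_def by blast
  \<comment> \<open>Then \<open>(M + 1) |Box| + (M + d + 1) > (M + d + 1) |Box|\<close>: the products \<open>a T\<^sup>j Y\<^sup>e\<close> and the powers
    of \<open>T\<close> together outnumber the generators of \<open>V (M + d)\<close>.\<close>
  define M where "M = d * card Box"
  define J1 where "J1 = {..M} \<times> Box"
  define J2 where "J2 = {..M + d}"
  define v where "v = case_sum (\<lambda>(j, e). a * (T ^ j * mon e)) (\<lambda>j. T ^ j)"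
  have cB: "card Box > 0" using k_ge by (auto simp: Box_def card_PiE)
  have "card (gens (M + d)) \<le> card ({..M + d} \<times> Box)"
    unfolding gens_def by (rule card_image_le) simp
  also have "\<dots> = (M + d + 1) * card Box" by (simp add: card_cartesian_product algebra_simps)
  also have "\<dots> < (M + 1) * card Box + (M + d + 1)"
    by (simp add: M_def algebra_simps)
  also have "\<dots> = card (J1 <+> J2)"
    by (simp add: card_Plus J1_def J2_def card_cartesian_product algebra_simps)
  finally have card: "card (gens (M + d)) < card (J1 <+> J2)" .
  have inV: "v x \<in> F.span (gens (M + d))" if x: "x \<in> J1 <+> J2" for x
  proof -
    show ?thesis
      using x d[OF in_V] power_T_in_V unfolding V_def[symmetric] by (auto simp: v_def J1_def J2_def)
  qed
  have fin: "finite J1" "finite J2" by (simp_all add: J1_def J2_def)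
  obtain c where c: "(\<Sum>x\<in>J1 <+> J2. \<iota> (c x) * v x) = 0" "\<exists>x\<in>J1 <+> J2. c x \<noteq> 0"
    using F.nontrivial_relation[where v = v, OF finite_Plus[OF fin] finite_gens card inV] by blast
  define b where "b = (\<Sum>(j, e)\<in>J1. \<iota> (c (Inl (j, e))) * (T ^ j * mon e))"
  define r where "r = (\<Sum>j\<in>J2. monom (c (Inr j)) j)"
  have "(\<Sum>x\<in>J1 <+> J2. \<iota> (c x) * v x) = a * b + pT r"
    by (simp add: sum.Plus fin v_def b_def r_def pT_sum pT_monom sum_distrib_left case_prod_unfold mult_ac)
  then have "a * b + pT r = 0" using c(1) by simp
  then have ab: "a * b = pT r" using eq_neg_iff_add_eq_0[of "a * b" "pT r"] by simp
  show ?thesis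
  proof (rule that)
    show "b \<in> V M" unfolding b_def by (intro V_sum) (auto simp: J1_def intro!: V_scale in_V)
    show "r \<noteq> 0"
    proof
      assume r: "r = 0"
      have "c (Inr j) = 0" if "j \<in> J2" for j
      proof -
        have "coeff r j = c (Inr j)" using that fin by (simp add: r_def coeff_sum)
        then show ?thesis using r by simp
      qed
      moreover have "b = 0" using ab r a(2) by simp
      then have "c (Inl (j, e)) = 0" if "(j, e) \<in> J1" for j e
        using monomials_independent[of J1 "c \<circ> Inl" j e] fin that by (auto simp: b_def J1_def)
      ultimately show False using c(2) by auto
    qed
  qed (fact ab)
qed

text \<open>The denominator of a quotient of elements of \<open>affine_ring\<close> divides a polynomial in \<open>T\<close>.\<close>

lemma denominator_in_base:
  obtains r p where "r \<noteq> 0" "pT r * f = comb p"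
proof -
  obtain g h where gh: "g \<in> affine_ring" "h \<in> affine_ring" "h \<noteq> 0" "f = g / h"
    using quotient_of_subring[OF affine_ring_subring mem12(2) xi_nonzero(2) coordinates_in_affine_ring] by blast
  obtain r b M where r: "r \<noteq> 0" "b \<in> V M" "h * b = pT r"
    using multiple_in_base[OF gh(2,3)] by blast
  obtain d where "g * b \<in> V (M + d)" using gh(1) r(2) unfolding affine_ring_def by blast
  then obtain p where "g * b = comb p" using V_imp_comb by blast
  moreover have "pT r * f = g * b" using gh r(3) by (simp flip: r(3))
  ultimately show ?thesis using that r(1) by simp
qed

text \<open>The coordinate ring of the affine part \<open>x\<^sub>2 \<noteq> 0\<close> is free over the polynomials in \<open>T\<close> with
  basis \<open>Y\<^sup>e\<close>, and it contains every function regular there: a zero of the denominator would be a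
  common zero of all numerators, so that it cancels.\<close>

lemma regular_on_affine_part_imp_comb:
  assumes "\<And>P. P \<in> curve \<Longrightarrow> P 2 = 1 \<Longrightarrow> \<exists>c. has_value P f c"
  obtains p where "f = comb p"
proof -
  have "\<exists>p. f = comb p" if "r \<noteq> 0" "pT r * f = comb p" for r p
    using that
  proof (induction "degree r" arbitrary: r p)
    case 0
    then obtain c where c: "r = [:c:]" using degree_eq_zeroE[of r] by metis
    with 0 have "c \<noteq> 0" by simp
    have "f = pT [:inverse c:] * comb p"
      using 0(3) \<open>c \<noteq> 0\<close> const_mult[of "inverse c" c] const_one
      by (simp add: c mult.assoc[symmetric] flip: 0(3))
    then show ?case unfolding comb_mult[symmetric] by blast
  next
    case (Suc d)
    then have "degree r > 0" by simp
    then obtain t where "poly r t = 0" using alg_closed_imp_poly_has_root by blast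
    then obtain r' where r': "r = [:- t, 1:] * r'" by (metis poly_eq_0_iff_dvd dvdE)
    with Suc.prems have "r' \<noteq> 0" by auto
    have "degree r = degree [:- t, 1:] + degree r'"
      unfolding r' by (rule degree_mult_eq) (use \<open>r' \<noteq> 0\<close> in auto)
    then have deg: "d = degree r'" using Suc.hyps(2) by simp
    have lin: "pT [:- t, 1:] = T - \<iota> t" by (simp add: const_one)
    have eq: "comb p = (T - \<iota> t) * (pT r' * f)"
      using Suc.prems(2) unfolding r' pT_mult lin by (simp only: mult.assoc)
    have root: "poly (p e) t = 0" if "e \<in> Box" for e
    proof (rule coefficients_vanish[OF _ eq that])
      fix P assume P: "P \<in> curve" "P 2 = 1" "P 1 = t"
      then show "\<exists>c. has_value P (pT r' * f) c"
        using assms[OF P(1,2)] has_value_mult value_pT[of P r'] by fastforce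
    qed
    have dvd: "[:- t, 1:] * (p e div [:- t, 1:]) = p e" if "e \<in> Box" for e
      using root[OF that] unfolding poly_eq_0_iff_dvd by (rule dvd_mult_div_cancel)
    have "comb p = comb (\<lambda>e. [:- t, 1:] * (p e div [:- t, 1:]))"
      unfolding comb_def by (rule sum.cong) (simp_all only: dvd)
    then have "comb p = (T - \<iota> t) * comb (\<lambda>e. p e div [:- t, 1:])"
      unfolding comb_mult lin .
    moreover have "T - \<iota> t \<noteq> 0"
    proof
      assume "T - \<iota> t = 0"
      then have "pT [:- t, 1:] = 0" using lin by simp
      moreover note e = zero_exponent_in_Box
      ultimately have "comb (\<lambda>f. if f = zero_exponent then [:- t, 1:] else 0) = 0"
        by (subst comb_single[OF e]) simp
      from comb_eq_zero[OF this e] show False by simp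
    qed
    ultimately have "pT r' * f = comb (\<lambda>e. p e div [:- t, 1:])" using eq by simp
    then show ?case using Suc.hyps(1)[OF deg \<open>r' \<noteq> 0\<close>] by blast
  qed
  then show ?thesis using denominator_in_base[of f] that by metis
qed

text \<open>\<open>Z\<^sub>2 = 1 / T\<close> vanishes at the points at infinity, where the vectors of values of the
  \<open>Z\<^sub>i = Y\<^sub>i / T\<close> form a grid. Multiplication by \<open>Z\<^sub>2\<^sup>M\<close> turns \<open>T\<^sup>j Y\<^sup>e\<close> into \<open>Z\<^sub>2\<^bsup>M-j-|e|\<^esup> Z\<^sup>e\<close>, so at infinity
  only the terms of top degree \<open>j + |e| = M\<close> contribute to the value, and the value is zero because
  multiplication by the smaller power \<open>Z\<^sub>2\<^bsup>M0\<^esup>\<close> already gives a regular function.\<close>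

lemma degree_bound_step:
  assumes f: "f = comb p"
    and reg: "\<And>P. P \<in> curve \<Longrightarrow> P 2 = 0 \<Longrightarrow> \<exists>c. has_value P (Z 2 ^ M0 * f) c"
    and high: "\<And>e j. e \<in> Box \<Longrightarrow> M < j + sum e I \<Longrightarrow> coeff (p e) j = 0"
    and M: "M0 < M" and e: "e \<in> Box" and j: "j + sum e I = M"
  shows "coeff (p e) j = 0"
proof -
  define b where "b e = (if sum e I \<le> M then coeff (p e) (M - sum e I) else 0)" for e
  have at_infinity: "Z 2 ^ M * (T ^ j * mon e) = Z 2 ^ (M - (j + sum e I)) * (\<Prod>i\<in>I. Z i ^ e i)"
    if "j + sum e I \<le> M" for j e
  proof -
    have "mon e = T ^ sum e I * (\<Prod>i\<in>I. Z i ^ e i)"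
      unfolding mon_def by (subst Y_eq) (simp add: power_mult_distrib prod.distrib power_sum)
    then have "Z 2 ^ (j + sum e I) * (T ^ j * mon e) = (Z 2 * T) ^ (j + sum e I) * (\<Prod>i\<in>I. Z i ^ e i)"
      by (simp only: power_add power_mult_distrib mult_ac)
    also have "Z 2 * T = 1" using T_nonzero Z2 by simp
    finally have "Z 2 ^ (M - (j + sum e I)) * (Z 2 ^ (j + sum e I) * (T ^ j * mon e)) =
        Z 2 ^ (M - (j + sum e I)) * (\<Prod>i\<in>I. Z i ^ e i)" by simp
    then show ?thesis
      unfolding mult.assoc[symmetric] power_add[symmetric] using that by (simp add: mult.assoc)
  qed
  have expand: "Z 2 ^ M * (pT (p e) * mon e) =
      (\<Sum>j\<in>{j. j + sum e I \<le> M}. \<iota> (coeff (p e) j) * (Z 2 ^ (M - (j + sum e I)) * (\<Prod>i\<in>I. Z i ^ e i)))"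
    if e: "e \<in> Box" for e
  proof -
    have "degree (p e) \<le> M" using high[OF e] by (intro degree_le) auto
    then have "Z 2 ^ M * (pT (p e) * mon e) = (\<Sum>j\<le>M. \<iota> (coeff (p e) j) * (Z 2 ^ M * (T ^ j * mon e)))"
      by (simp add: pT_altdef sum_distrib_left sum_distrib_right mult_ac)
    also have "\<dots> = (\<Sum>j\<in>{j. j + sum e I \<le> M}. \<iota> (coeff (p e) j) * (Z 2 ^ M * (T ^ j * mon e)))"
      by (rule sum.mono_neutral_right) (auto simp: high[OF e])
    also have "\<dots> = (\<Sum>j\<in>{j. j + sum e I \<le> M}. \<iota> (coeff (p e) j) * (Z 2 ^ (M - (j + sum e I)) * (\<Prod>i\<in>I. Z i ^ e i)))"
      by (rule sum.cong) (simp_all add: at_infinity)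
    finally show ?thesis .
  qed
  have "b e = 0"
  proof (rule vanishing_on_grid[where I=I and k=k and S="\<lambda>i. {r. r ^ k = L i}" and c=b])
    show "k \<le> card {r. r ^ k = L i}" if "i \<in> I" for i
      using card_kth_roots[OF L_nonzero[OF that], of k] k_ge of_nat_k by simp
  next
    fix r assume "r \<in> Pi\<^sub>E I (\<lambda>i. {r. r ^ k = L i})"
    then have r: "\<And>i. i \<in> I \<Longrightarrow> r i ^ k = L i" by auto
    define P where "P = infinite_point r"
    have P: "P \<in> curve" "P 1 = 1" "P 2 = 0" "\<And>i. i \<in> I \<Longrightarrow> P i = r i"
      using infinite_point_in_curve[OF r] by (simp_all add: P_def)
    have vZ: "has_value P (Z i) (r i)" if "i \<in> I" for i
      using value_Z[of P i] P that I_range by auto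
    have vZ2: "has_value P (Z 2) 0" using value_Z[OF _ mem12(2), of P] P by simp
    have "has_value P (Z 2 ^ M * f)
        (\<Sum>e\<in>Box. \<Sum>j\<in>{j. j + sum e I \<le> M}. coeff (p e) j * (0 ^ (M - (j + sum e I)) * (\<Prod>i\<in>I. r i ^ e i)))"
      unfolding f comb_def sum_distrib_left
      by (intro has_value_sum[OF P(1)], simp only: expand,
          intro has_value_sum[OF P(1)] has_value_mult has_value_const has_value_power vZ2 has_value_prod vZ)
    moreover have "(\<Sum>j\<in>{j. j + sum e I \<le> M}. coeff (p e) j * (0 ^ (M - (j + sum e I)) * (\<Prod>i\<in>I. r i ^ e i)))
        = b e * (\<Prod>i\<in>I. r i ^ e i)" for e
    proof -
      have "(\<Sum>j\<in>{j. j + sum e I \<le> M}. coeff (p e) j * (0 ^ (M - (j + sum e I)) * (\<Prod>i\<in>I. r i ^ e i)))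
        = (\<Sum>j\<in>{j. j + sum e I = M}. coeff (p e) j * (\<Prod>i\<in>I. r i ^ e i))"
        by (rule sum.mono_neutral_cong_right) (auto simp: power_0_left intro: finite_subset[of _ "{..M}"])
      also have "{j. j + sum e I = M} = (if sum e I \<le> M then {M - sum e I} else {})" by auto
      finally show ?thesis by (simp add: b_def)
    qed
    ultimately have "has_value P (Z 2 ^ M * f) (\<Sum>e\<in>Box. b e * (\<Prod>i\<in>I. r i ^ e i))" by simp
    moreover obtain c where c: "has_value P (Z 2 ^ M0 * f) c" using reg P by blast
    have split: "Z 2 ^ M * f = Z 2 ^ (M - M0) * (Z 2 ^ M0 * f)"
      using M by (simp add: mult.assoc[symmetric] flip: power_add)
    have "has_value P (Z 2 ^ M * f) (0 ^ (M - M0) * c)"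
      unfolding split by (intro has_value_mult has_value_power vZ2 c)
    ultimately show "(\<Sum>e\<in>Pi\<^sub>E I (\<lambda>_. {..<k}). b e * (\<Prod>i\<in>I. r i ^ e i)) = 0"
      using has_value_unique[OF P(1)] M by (fastforce simp: Box_def power_0_left)
  qed (use e in \<open>auto simp: Box_def\<close>)
  moreover have "sum e I \<le> M" "M - sum e I = j" using j by auto
  ultimately show ?thesis by (simp add: b_def)
qed

text \<open>The step is iterated downwards from any bound for the degrees that occur in \<open>f\<close>.\<close>

lemma bounded_pole_imp_V:
  assumes fin: "\<And>P. P \<in> curve \<Longrightarrow> P 2 = 1 \<Longrightarrow> \<exists>c. has_value P f c"
    and inf: "\<And>P. P \<in> curve \<Longrightarrow> P 2 = 0 \<Longrightarrow> \<exists>c. has_value P (Z 2 ^ M0 * f) c"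
  shows "f \<in> V M0"
proof -
  obtain p where p: "f = comb p" using regular_on_affine_part_imp_comb[OF fin] by blast
  define D where "D = (\<Sum>e\<in>Box. degree (p e) + sum e I)"
  have D: "coeff (p e) j = 0" if "e \<in> Box" "M0 + D < j + sum e I" for e j
  proof -
    have "degree (p e) + sum e I \<le> D"
      unfolding D_def using member_le_sum[of e Box "\<lambda>e. degree (p e) + sum e I"] that by simp
    then show ?thesis using that by (intro coeff_eq_0) simp
  qed
  have "\<forall>e\<in>Box. \<forall>j. M0 + d < j + sum e I \<longrightarrow> coeff (p e) j = 0" if "d \<le> D" for d
    using that
  proof (induction rule: inc_induct)
    case base
    then show ?case using D by blast
  next
    case (step d)
    show ?case
    proof (intro ballI allI impI)
      fix e j assume e: "e \<in> Box" and j: "M0 + d < j + sum e I"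
      show "coeff (p e) j = 0"
      proof (cases "j + sum e I = M0 + Suc d")
        case True
        show ?thesis
          by (rule degree_bound_step[OF p inf _ _ e True]) (use step.IH in auto)
      next
        case False
        then show ?thesis using step.IH e j by auto
      qed
    qed
  qed
  from this[of 0] show ?thesis unfolding p by (intro comb_in_V) auto
qed

end

section \<open>The differential of the coordinate \<open>T\<close>\<close>

text \<open>The nonsquare \<open>z\<close> is the function with respect to which the Cartier operator is computed. Its
  existence is also what prevents \<open>T\<close> from being a square.\<close>

locale fermat_nonsquare = fermat_function_field n k l \<iota> \<xi>
  for n k :: nat and l :: "nat \<Rightarrow> 'a::alg_closed_field" and \<iota> :: "'a \<Rightarrow> 'f::field" and \<xi> +
  fixes z :: 'f
  assumes nonsquare: "z \<notin> range (\<lambda>u. u\<^sup>2)"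
begin

definition m :: nat where "m = k div 2"

lemma k_eq: "k = 2 * m + 1" using k_odd by (auto simp: m_def elim!: oddE)

lemma power_k: "x ^ k = x * (x ^ m)\<^sup>2" and power_k_diff_one: "x ^ (k - 1) = (x ^ m)\<^sup>2"
  for x :: 'f
proof -
  have "(x ^ m)\<^sup>2 = x ^ (2 * m)" by (simp add: mult.commute flip: power_mult)
  moreover have "x ^ k = x * x ^ (2 * m)" using arg_cong[OF k_eq, of "\<lambda>j. x ^ j"] by (simp add: power_add)
  moreover have "k - 1 = 2 * m" using k_eq by linarith
  ultimately show "x ^ k = x * (x ^ m)\<^sup>2" "x ^ (k - 1) = (x ^ m)\<^sup>2" by simp_all
qed

lemma const_square: obtains s where "\<iota> c = (\<iota> s)\<^sup>2"
  using nth_root_exists[of 2 c] const_power[of _ 2] by (metis zero_less_numeral)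

text \<open>The functions \<open>a\<^sup>2 + b\<^sup>2 T\<close> form a ring because squaring is additive; it contains constants and
  coordinates, and it is closed under quotients as \<open>g / h = g h (1 / h)\<^sup>2\<close>.\<close>

lemma square_decomposition: obtains a b where "f = a\<^sup>2 + b\<^sup>2 * T"
proof -
  define R where "R = {a\<^sup>2 + b\<^sup>2 * T | a b. True}"
  have R: "f \<in> R \<longleftrightarrow> (\<exists>a b. f = a\<^sup>2 + b\<^sup>2 * T)" for f by (auto simp: R_def)
  have sub: "subring_over \<iota> R"
    unfolding subring_over_def
  proof (intro conjI subsetI ballI)
    fix f assume "f \<in> range \<iota>"
    then obtain c where "f = \<iota> c" by blast
    moreover obtain s where "\<iota> c = (\<iota> s)\<^sup>2" by (rule const_square)
    ultimately have "f = (\<iota> s)\<^sup>2 + 0\<^sup>2 * T" by simp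
    then show "f \<in> R" unfolding R by blast
  next
    fix f g assume "f \<in> R" "g \<in> R"
    then obtain a b c d where fg: "f = a\<^sup>2 + b\<^sup>2 * T" "g = c\<^sup>2 + d\<^sup>2 * T" unfolding R by blast
    have "f + g = (a + c)\<^sup>2 + (b + d)\<^sup>2 * T"
      by (simp only: fg square_add algebra_simps)
    then show "f + g \<in> R" unfolding R by blast
    have "f * g = (a * c + b * d * T)\<^sup>2 + (a * d + b * c)\<^sup>2 * T"
      unfolding square_add by (simp add: fg power2_eq_square algebra_simps)
    then show "f * g \<in> R" unfolding R by blast
  qed
  have gen: "Y i \<in> R" if "i \<in> {1..n + 1}" for i
  proof -
    consider "i = 1" | "i = 2" | "i \<in> I" using coordinate_cases[OF \<open>i \<in> _\<close>] by blast
    then show ?thesis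
    proof cases
      case 1
      have "Y i = 0\<^sup>2 + 1\<^sup>2 * T" using 1 by simp
      then show ?thesis unfolding R by blast
    next
      case 2
      have "Y i = 1\<^sup>2 + 0\<^sup>2 * T" using 2 by simp
      then show ?thesis unfolding R by blast
    next
      case 3
      obtain s where s: "\<iota> (L i) = (\<iota> s)\<^sup>2" by (rule const_square)
      have "Y i * (Y i ^ m)\<^sup>2 = \<iota> (L i) * T ^ k + 1"
        using curve_equation[OF 3] by (simp only: power_k)
      also have "\<dots> = 1\<^sup>2 + (\<iota> s * T ^ m)\<^sup>2 * T"
        unfolding s power_k by (simp add: power_mult_distrib mult_ac)
      finally have "Y i = (1 / Y i ^ m)\<^sup>2 + (\<iota> s * T ^ m / Y i ^ m)\<^sup>2 * T"
        using Y_nonzero[OF 3] by (simp add: power_divide field_simps)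
      then show ?thesis unfolding R by blast
    qed
  qed
  obtain g h where gh: "g \<in> R" "h \<in> R" "h \<noteq> 0" "f = g / h"
    using quotient_of_subring[OF sub mem12(2) xi_nonzero(2) gen] by blast
  obtain a b where "g * h = a\<^sup>2 + b\<^sup>2 * T" using subring_overD(3)[OF sub gh(1,2)] unfolding R by blast
  moreover have "f = g * h / h\<^sup>2" using gh by (simp add: power2_eq_square)
  ultimately have "f = (a / h)\<^sup>2 + (b / h)\<^sup>2 * T" by (simp add: power_divide add_divide_distrib)
  then show ?thesis using that by blast
qed

text \<open>Otherwise every function, including \<open>z\<close>, would be a square.\<close>

lemma T_nonsquare: "T \<noteq> u\<^sup>2"
proof
  assume T: "T = u\<^sup>2"
  obtain a b where "z = a\<^sup>2 + b\<^sup>2 * T" by (rule square_decomposition)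
  then have "z = (a + b * u)\<^sup>2" by (simp add: T square_add power_mult_distrib)
  then show False using nonsquare by blast
qed

lemma square_decomposition_unique:
  assumes "a\<^sup>2 + b\<^sup>2 * T = c\<^sup>2 + d\<^sup>2 * T"
  shows "b = d"
proof (rule ccontr)
  assume "b \<noteq> d"
  then have ne: "(b - d)\<^sup>2 \<noteq> 0" by simp
  have sq: "(x - y)\<^sup>2 = x\<^sup>2 - y\<^sup>2" for x y :: 'f
    using square_add[of x "- y"] by (simp only: diff_conv_add_uminus uminus_eq)
  have "(b - d)\<^sup>2 * T = (c - a)\<^sup>2"
    unfolding sq left_diff_distrib by (rule diff_eq_diff_if_add_eq_add[OF assms])
  then have "T = ((c - a) / (b - d))\<^sup>2" using ne by (simp add: power_divide field_simps)
  then show False using T_nonsquare by blast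
qed

text \<open>The derivation \<open>d / dT\<close>.\<close>

definition DT :: "'f \<Rightarrow> 'f" where "DT f = (SOME b. \<exists>a. f = a\<^sup>2 + b\<^sup>2 * T)\<^sup>2"

lemma DT_eq: "DT (a\<^sup>2 + b\<^sup>2 * T) = b\<^sup>2"
proof -
  have "\<exists>a'. a\<^sup>2 + b\<^sup>2 * T = a'\<^sup>2 + (SOME b'. \<exists>a'. a\<^sup>2 + b\<^sup>2 * T = a'\<^sup>2 + b'\<^sup>2 * T)\<^sup>2 * T"
    by (rule someI[of "\<lambda>b'. \<exists>a'. a\<^sup>2 + b\<^sup>2 * T = a'\<^sup>2 + b'\<^sup>2 * T" b]) blast
  then obtain a' where "a\<^sup>2 + b\<^sup>2 * T = a'\<^sup>2 + (SOME b'. \<exists>a'. a\<^sup>2 + b\<^sup>2 * T = a'\<^sup>2 + b'\<^sup>2 * T)\<^sup>2 * T" by blast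
  from square_decomposition_unique[OF this] show ?thesis by (simp add: DT_def)
qed

lemma derivation_DT: "derivation \<iota> DT"
  unfolding derivation_def
proof (intro conjI allI)
  fix f g
  obtain a b where f: "f = a\<^sup>2 + b\<^sup>2 * T" by (rule square_decomposition)
  obtain c d where g: "g = c\<^sup>2 + d\<^sup>2 * T" by (rule square_decomposition)
  have "f + g = (a + c)\<^sup>2 + (b + d)\<^sup>2 * T"
    by (simp only: f g square_add algebra_simps)
  then have "DT (f + g) = (b + d)\<^sup>2" by (simp only: DT_eq)
  moreover have "DT f = b\<^sup>2" "DT g = d\<^sup>2" by (simp_all only: f g DT_eq)
  ultimately show "DT (f + g) = DT f + DT g" by (simp only: square_add)
  have "f * g = (a * c + b * d * T)\<^sup>2 + (a * d + b * c)\<^sup>2 * T"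
    unfolding square_add by (simp add: f g power2_eq_square algebra_simps)
  then have "DT (f * g) = (a * d + b * c)\<^sup>2" by (simp only: DT_eq)
  also have "\<dots> = (a * d)\<^sup>2 + (b * c)\<^sup>2" by (rule square_add)
  also have "\<dots> = f * DT g + g * DT f"
    unfolding f g DT_eq by (simp add: power2_eq_square algebra_simps)
  finally show "DT (f * g) = f * DT g + g * DT f" .
next
  fix c
  obtain s where "\<iota> c = (\<iota> s)\<^sup>2" by (rule const_square)
  then have "\<iota> c = (\<iota> s)\<^sup>2 + 0\<^sup>2 * T" by simp
  then show "DT (\<iota> c) = 0" by (simp only: DT_eq) simp
qed

lemma DT_T [simp]: "DT T = 1"
  using DT_eq[of 0 1] by simp

text \<open>A derivation kills squares, so it is determined by its value at \<open>T\<close>.\<close>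

lemma derivation_eq_DT:
  assumes D: "derivation \<iota> D"
  shows "D f = DT f * D T"
proof -
  obtain a b where f: "f = a\<^sup>2 + b\<^sup>2 * T" by (rule square_decomposition)
  have "D (g\<^sup>2) = 0" for g using derivationD(2)[OF D, of g g] by (simp add: power2_eq_square)
  then have "D f = b\<^sup>2 * D T" by (simp add: f derivationD[OF D])
  then show ?thesis by (simp only: f DT_eq)
qed

abbreviation dT :: "'f one_form" where "dT \<equiv> differential \<iota> T"

lemma differential_eq: "differential \<iota> g = scale_form (DT g) dT"
  by (auto simp: differential_def scale_form_def derivation_eq_DT[of _ g])

lemma scale_dT_at_DT: "scale_form h dT DT = h"
  by (simp add: scale_form_def differential_def derivation_DT)

section \<open>Squares times \<open>dT\<close> are killed by the Cartier operator\<close>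

text \<open>If \<open>z = a\<^sup>2 + b\<^sup>2 T\<close>, then \<open>dz = b\<^sup>2 dT\<close> with \<open>b \<noteq> 0\<close>, so \<open>w\<^sup>2 dT = (w / b)\<^sup>2 dz\<close> has no component at
  \<open>z dz\<close>. The components are unique because \<open>z\<close> is not a square.\<close>

lemma cartier_square:
  "cartier \<iota> z (scale_form (w\<^sup>2) dT) = 0"
proof -
  obtain a b where zab: "z = a\<^sup>2 + b\<^sup>2 * T" by (rule square_decomposition)
  have b: "b \<noteq> 0" using nonsquare zab by auto
  have DTz: "DT z = b\<^sup>2" by (simp only: zab DT_eq)
  then have dz: "differential \<iota> z = scale_form (b\<^sup>2) dT" by (simp only: differential_eq[of z])
  have sum2: "(\<Sum>i<2. u i ^ 2 * z ^ i) = (u 0)\<^sup>2 + (u 1)\<^sup>2 * z" for u :: "nat \<Rightarrow> 'f"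
    by (simp add: numeral_2_eq_2 One_nat_def)
  show ?thesis
    unfolding cartier_def char_two_ff sum2
  proof (rule the_equality)
    have "scale_form (w\<^sup>2) dT = scale_form ((w / b)\<^sup>2 + 0\<^sup>2 * z) (differential \<iota> z)"
      using b by (simp add: dz scale_form_def power_divide)
    then show "\<exists>u :: nat \<Rightarrow> 'f. scale_form (w\<^sup>2) dT = scale_form ((u 0)\<^sup>2 + (u 1)\<^sup>2 * z) (differential \<iota> z) \<and>
        0 = scale_form (u (2 - 1)) (differential \<iota> z)"
      by (intro exI[of _ "\<lambda>i. if i = 0 then w / b else 0"]) (simp add: scale_form_def fun_eq_iff)
  next
    fix \<eta>
    assume "\<exists>u :: nat \<Rightarrow> 'f. scale_form (w\<^sup>2) dT = scale_form ((u 0)\<^sup>2 + (u 1)\<^sup>2 * z) (differential \<iota> z) \<and>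
        \<eta> = scale_form (u (2 - 1)) (differential \<iota> z)"
    then obtain u :: "nat \<Rightarrow> 'f" where u: "scale_form (w\<^sup>2) dT = scale_form ((u 0)\<^sup>2 + (u 1)\<^sup>2 * z) (differential \<iota> z)"
      "\<eta> = scale_form (u (2 - 1)) (differential \<iota> z)" by blast
    have "w\<^sup>2 = ((u 0)\<^sup>2 + (u 1)\<^sup>2 * z) * b\<^sup>2"
      using arg_cong[OF u(1), of "\<lambda>\<omega>. \<omega> DT"] by (simp add: scale_form_def differential_def derivation_DT DTz)
    also have "\<dots> = (u 0 * b + u 1 * a * b)\<^sup>2 + (u 1 * b * b)\<^sup>2 * T"
      unfolding square_add zab by (simp add: power_mult_distrib algebra_simps)
    finally have "w\<^sup>2 + 0\<^sup>2 * T = (u 0 * b + u 1 * a * b)\<^sup>2 + (u 1 * b * b)\<^sup>2 * T" by simp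
    from square_decomposition_unique[OF this] have "u 1 = 0" using b by simp
    then have "u (2 - 1) = 0" by (simp add: One_nat_def)
    then show "\<eta> = 0" by (simp add: u(2) scale_form_def fun_eq_iff)
  qed
qed

section \<open>Poles of differentials\<close>

lemma DT_power_k: "DT (f ^ k) = f ^ (k - 1) * DT f"
proof -
  have "k = Suc (k - 1)" using k_ge by simp
  then show ?thesis
    using derivation_power[OF derivation_DT, of f "k - 1"] of_nat_k(2) by simp
qed

lemma DT_equation: "Y i ^ (k - 1) * DT (Y i) = \<iota> (L i) * T ^ (k - 1)" if "i \<in> I"
proof -
  have "DT (Y i ^ k) = \<iota> (L i) * DT (T ^ k)"
    unfolding curve_equation[OF that]
    by (simp add: derivationD[OF derivation_DT] derivation_one[OF derivation_DT])
  then show ?thesis by (simp add: DT_power_k)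
qed

lemma DT_Z2: "DT (Z 2) = (Z 2)\<^sup>2"
  using derivation_inverse[OF derivation_DT, of T] by (simp add: Z2)

lemma DT_Z: "DT (Z i) = Z 2 ^ (k + 1) * inverse (Z i) ^ (k - 1)" if "i \<in> I"
proof -
  have "DT (Z i ^ k) = DT (Z 2 ^ k)"
    unfolding curve_equation_at_infinity[OF that]
    by (simp add: derivationD[OF derivation_DT])
  then have "Z i ^ (k - 1) * DT (Z i) = Z 2 ^ (k - 1) * (Z 2)\<^sup>2" by (simp add: DT_Z2 DT_power_k)
  also have "\<dots> = Z 2 ^ (k - 1 + 2)" by (rule power_add[symmetric])
  also have "k - 1 + 2 = k + 1" using k_ge by simp
  finally have "DT (Z i) = Z 2 ^ (k + 1) / Z i ^ (k - 1)"
    using Y_nonzero[OF that] Y_eq[of i] by (simp add: field_simps)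
  then show ?thesis by (simp add: field_class.field_divide_inverse power_inverse)
qed

text \<open>Equal to \<open>\<Prod> (L\<^sub>i T\<^sup>k + 1)\<close>: its zeros on the affine part are the points where \<open>dT\<close> does not generate
  the regular forms.\<close>

definition branch_product :: "'f" where "branch_product = (\<Prod>i\<in>I. Y i ^ k)"

lemma branch_product_nonzero: "branch_product \<noteq> 0" using Y_nonzero by (simp add: branch_product_def)

text \<open>\<open>branch_product * DT(Y\<^sub>i)\<close> is a polynomial in the coordinates by \<open>DT_equation\<close>.\<close>

lemma DT_regular_affine:
  assumes P: "P \<in> curve" "P 2 \<noteq> 0" and f: "has_value P f c"
  shows "\<exists>c. has_value P (branch_product * DT f) c"
proof -
  have vY: "has_value P (Y i) (P i / P 2)" if "i \<in> {1..n + 1}" for i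
    using value_Y P that by blast
  have v_branch: "has_value P branch_product (\<Prod>i\<in>I. (P i / P 2) ^ k)"
    unfolding branch_product_def by (intro has_value_prod has_value_power vY I_range)
  show ?thesis
  proof (rule derivation_preserves_local_ring[OF derivation_DT P(1) mem12(2) P(2) v_branch _ f])
    fix i assume "i \<in> {1..n + 1}"
    then consider "i = 1" | "i = 2" | "i \<in> I" using coordinate_cases by blast
    then show "\<exists>c. has_value P (branch_product * DT (Y i)) c"
    proof cases
      case 1
      then show ?thesis using v_branch by auto
    next
      case 2
      then show ?thesis using has_value_const[of P 0] by (auto simp: derivation_one[OF derivation_DT])
    next
      case 3
      have "branch_product = Y i * Y i ^ (k - 1) * (\<Prod>j\<in>I - {i}. Y j ^ k)"
        unfolding branch_product_def using 3 k_ge by (subst prod.remove[of _ i]) (simp_all flip: power_Suc)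
      then have "branch_product * DT (Y i) = Y i * (\<iota> (L i) * T ^ (k - 1)) * (\<Prod>j\<in>I - {i}. Y j ^ k)"
        using DT_equation[OF 3] by (simp add: mult_ac)
      moreover have "has_value P \<dots>
          (P i / P 2 * (L i * (P 1 / P 2) ^ (k - 1)) * (\<Prod>j\<in>I - {i}. (P j / P 2) ^ k))"
        using 3 by (intro has_value_mult has_value_prod has_value_power has_value_const vY) (auto simp: I_range simp del: atLeastAtMost_iff)
      ultimately show ?thesis by auto
    qed
  qed
qed

lemma DT_regular_infinity:
  assumes P: "P \<in> curve" "P 2 = 0" and f: "has_value P f c"
  shows "\<exists>c. has_value P (DT f) c"
proof -
  note nz = nonzero_coordinates_at_infinity[OF P]
  have vZ: "has_value P (Z i) (P i / P 1)" if "i \<in> {1..n + 1}" for i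
    using value_Z nz(1) that by blast
  have one: "has_value P 1 1" using has_value_const[of P 1] by (simp add: const_one)
  have "\<exists>c. has_value P (1 * DT f) c"
  proof (rule derivation_preserves_local_ring[OF derivation_DT P(1) mem12(1) nz(1) one _ f])
    fix i assume "i \<in> {1..n + 1}"
    then consider "i = 1" | "i = 2" | "i \<in> I" using coordinate_cases by blast
    then show "\<exists>c. has_value P (1 * DT (Z i)) c"
    proof cases
      case 1
      then show ?thesis
        using has_value_const[of P 0] Z1 by (auto simp: derivation_one[OF derivation_DT])
    next
      case 2
      then show ?thesis using has_value_power[OF vZ[OF mem12(2)], of 2] by (auto simp: DT_Z2)
    next
      case 3
      have "has_value P (Z 2 ^ (k + 1) * inverse (Z i) ^ (k - 1))
          ((P 2 / P 1) ^ (k + 1) * inverse (P i / P 1) ^ (k - 1))"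
        using 3 nz by (intro has_value_mult has_value_power has_value_inverse vZ) (auto simp: I_range simp del: atLeastAtMost_iff)
      then show ?thesis using DT_Z[OF 3] by auto
    qed
  qed
  then show ?thesis by simp
qed

section \<open>The space of holomorphic forms is finite-dimensional\<close>

sublocale Om: vector_space "\<lambda>c. scale_form (\<iota> c)"
  by (rule vector_space_scale_form)

lemma regular_at_imp:
  assumes "regular_at (n + 1) \<iota> \<xi> P \<omega>"
  obtains N :: nat and f g where "\<And>i. i < N \<Longrightarrow> \<exists>c. has_value P (f i) c" "\<And>i. i < N \<Longrightarrow> \<exists>c. has_value P (g i) c"
    "\<omega> = scale_form (\<Sum>i<N. f i * DT (g i)) dT"
proof -
  obtain N :: nat and f g where 1: "\<forall>i<N. f i \<in> local_ring (n + 1) \<iota> \<xi> P \<and> g i \<in> local_ring (n + 1) \<iota> \<xi> P"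
    "\<omega> = (\<Sum>i<N. scale_form (f i) (differential \<iota> (g i)))"
    using assms unfolding regular_at_def by blast
  have "(\<Sum>i<N. scale_form (f i) (differential \<iota> (g i))) = scale_form (\<Sum>i<N. f i * DT (g i)) dT"
    unfolding differential_eq[of "g _"]
    by (induction N) (simp_all add: scale_form_def fun_eq_iff algebra_simps)
  then have "\<omega> = scale_form (\<Sum>i<N. f i * DT (g i)) dT" using 1(2) by simp
  then show ?thesis by (intro that[of N f g]) (use 1(1) in \<open>simp_all add: local_ring_iff\<close>)
qed

text \<open>Let the form be \<open>h dT\<close>. Then \<open>branch_product * h\<close> is regular on the affine part. At infinity \<open>h\<close> is
  regular and \<open>branch_product = T\<^bsup>k |I|\<^esup> \<Prod> Z\<^sub>i\<^sup>k\<close> has a pole that \<open>Z\<^sub>2\<^bsup>k |I|\<^esup>\<close> removes.\<close>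

lemma holomorphic_imp_V:
  assumes "\<omega> \<in> holomorphic_forms (n + 1) curve \<iota> \<xi>"
  obtains f where "f \<in> V (k * card I)" "\<omega> = scale_form (f / branch_product) dT"
proof -
  have reg: "regular_at (n + 1) \<iota> \<xi> P \<omega>" if "P \<in> curve" for P
    using assms that by (simp add: holomorphic_forms_def)
  define h where "h = \<omega> DT"
  have "branch_product * h \<in> V (k * card I)"
  proof (rule bounded_pole_imp_V)
    fix P assume P: "P \<in> curve" "P 2 = 1"
    obtain N :: nat and f g where fg: "\<And>i. i < N \<Longrightarrow> \<exists>c. has_value P (f i) c" "\<And>i. i < N \<Longrightarrow> \<exists>c. has_value P (g i) c"
      "\<omega> = scale_form (\<Sum>i<N. f i * DT (g i)) dT"
      using regular_at_imp[OF reg[OF P(1)]] by blast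
    have "\<exists>c. has_value P (f i * (branch_product * DT (g i))) c" if "i < N" for i
      using fg(1,2)[OF that] DT_regular_affine[OF P(1), of "g i"] P(2) has_value_mult by (metis zero_neq_one)
    then obtain c where "\<And>i. i < N \<Longrightarrow> has_value P (f i * (branch_product * DT (g i))) (c i)" by metis
    then have "has_value P (\<Sum>i<N. f i * (branch_product * DT (g i))) (\<Sum>i<N. c i)"
      by (intro has_value_sum[OF P(1)]) auto
    moreover have "branch_product * h = (\<Sum>i<N. f i * (branch_product * DT (g i)))"
      unfolding h_def fg(3) scale_dT_at_DT by (simp add: sum_distrib_left mult_ac)
    ultimately show "\<exists>c. has_value P (branch_product * h) c" by auto
  next
    fix P assume P: "P \<in> curve" "P 2 = 0"
    note nz = nonzero_coordinates_at_infinity[OF P]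
    obtain N :: nat and f g where fg: "\<And>i. i < N \<Longrightarrow> \<exists>c. has_value P (f i) c" "\<And>i. i < N \<Longrightarrow> \<exists>c. has_value P (g i) c"
      "\<omega> = scale_form (\<Sum>i<N. f i * DT (g i)) dT"
      using regular_at_imp[OF reg[OF P(1)]] by blast
    have "\<exists>c. has_value P (f i * DT (g i)) c" if "i < N" for i
      using fg(1,2)[OF that] DT_regular_infinity[OF P, of "g i"] has_value_mult by metis
    then obtain c where "\<And>i. i < N \<Longrightarrow> has_value P (f i * DT (g i)) (c i)" by metis
    then have "has_value P (\<Sum>i<N. f i * DT (g i)) (\<Sum>i<N. c i)"
      by (intro has_value_sum[OF P(1)]) auto
    then have vh: "has_value P h (\<Sum>i<N. c i)" unfolding h_def fg(3) scale_dT_at_DT .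
    have "Z 2 ^ (k * card I) * branch_product = (\<Prod>i\<in>I. Z 2 ^ k * Y i ^ k)"
      by (simp add: branch_product_def prod.distrib power_mult)
    also have "\<dots> = (\<Prod>i\<in>I. Z i ^ k)"
    proof (rule prod.cong[OF refl])
      fix i
      have "Z 2 * Y i = Z i" using Y_eq[of i] Z2 T_nonzero by simp
      then show "Z 2 ^ k * Y i ^ k = Z i ^ k" by (metis power_mult_distrib)
    qed
    finally have "Z 2 ^ (k * card I) * branch_product = (\<Prod>i\<in>I. Z i ^ k)" .
    then have eq: "Z 2 ^ (k * card I) * (branch_product * h) = (\<Prod>i\<in>I. Z i ^ k) * h"
      by (simp only: mult.assoc[symmetric])
    have "has_value P ((\<Prod>i\<in>I. Z i ^ k) * h) ((\<Prod>i\<in>I. (P i / P 1) ^ k) * (\<Sum>i<N. c i))"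
      using nz(1) by (intro has_value_mult has_value_prod has_value_power value_Z vh) (auto simp: I_range simp del: atLeastAtMost_iff)
    then show "\<exists>c. has_value P (Z 2 ^ (k * card I) * (branch_product * h)) c" unfolding eq by blast
  qed
  moreover have "\<omega> = scale_form h dT"
  proof -
    obtain P where "P \<in> curve" using affine_point_exists by blast
    then obtain g where "\<omega> = scale_form g dT" using regular_at_imp[OF reg] by metis
    then show ?thesis by (simp add: h_def scale_dT_at_DT)
  qed
  then have "\<omega> = scale_form (branch_product * h / branch_product) dT" using branch_product_nonzero by simp
  ultimately show ?thesis using that by blast
qed

definition form_gens :: "'f one_form set" where
  "form_gens = (\<lambda>f. scale_form (f / branch_product) dT) ` gens (k * card I)"

lemma holomorphic_in_span:
  assumes "\<omega> \<in> holomorphic_forms (n + 1) curve \<iota> \<xi>"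
  shows "\<omega> \<in> Om.span form_gens"
proof -
  obtain f where f: "f \<in> V (k * card I)" "\<omega> = scale_form (f / branch_product) dT"
    using holomorphic_imp_V[OF assms] by blast
  have "scale_form (f / branch_product) dT \<in> Om.span form_gens"
    using f(1) unfolding V_def
  proof (induction rule: F.span_induct_alt)
    case base
    have "scale_form (0 / branch_product) dT = 0" by (simp add: scale_form_def fun_eq_iff)
    then show ?case using Om.span_zero by metis
  next
    case (step c f g)
    have "scale_form (f / branch_product) dT \<in> Om.span form_gens"
      using step.hyps by (intro Om.span_base) (auto simp: form_gens_def)
    then have "scale_form (\<iota> c) (scale_form (f / branch_product) dT) + scale_form (g / branch_product) dT \<in> Om.span form_gens"
      by (intro Om.span_add Om.span_scale step.IH)
    moreover have "scale_form (\<iota> c) (scale_form (f / branch_product) dT) + scale_form (g / branch_product) dT = scale_form ((\<iota> c * f + g) / branch_product) dT"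
      by (simp add: scale_form_def fun_eq_iff add_divide_distrib distrib_right mult.assoc)
    ultimately show ?case by simp
  qed
  then show ?thesis by (simp add: f(2))
qed

section \<open>Exact holomorphic forms\<close>

text \<open>The pairs of an exponent vector \<open>c\<close> and an exponent \<open>b\<close> for which \<open>T\<^sup>b / Y\<^sup>c\<close> is the square root of
  the coefficient of a holomorphic form.\<close>

definition expos :: "((nat \<Rightarrow> nat) \<times> nat) set" where
  "expos = (SIGMA c:Pi\<^sub>E I (\<lambda>_. {..m}). {..<sum c I})"

definition root_of_form :: "(nat \<Rightarrow> nat) \<times> nat \<Rightarrow> 'f" where
  "root_of_form = (\<lambda>(c, b). T ^ b * (\<Prod>i\<in>I. inverse (Y i) ^ c i))"

definition square_form :: "(nat \<Rightarrow> nat) \<times> nat \<Rightarrow> 'f one_form" where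
  "square_form x = scale_form ((root_of_form x)\<^sup>2) dT"

lemma finite_expos [simp]: "finite expos"
  unfolding expos_def by (intro finite_SigmaI finite_PiE) auto

lemma regular_at_scale_dT:
  assumes "h = f * DT g" "has_value P f c" "has_value P g c'"
  shows "regular_at (n + 1) \<iota> \<xi> P (scale_form h dT)"
proof -
  have "scale_form h dT = scale_form f (differential \<iota> g)"
    unfolding assms(1) differential_eq[of g] by (simp add: scale_form_def mult.assoc)
  then show ?thesis using regular_atI assms(2,3) by metis
qed

text \<open>There are three kinds of points. At infinity \<open>dT = Z\<^sub>2\<^bsup>-2\<^esup> dZ\<^sub>2\<close> and \<open>T\<^sup>b / Y\<^sup>c = Z\<^sub>2\<^bsup>|c|-b\<^esup> / Z\<^sup>c\<close>, which
  is regular after division by \<open>Z\<^sub>2\<close> since \<open>b < |c|\<close>. At affine points with all \<open>Y\<^sub>i\<close> nonzero,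
  everything in sight is regular. If \<open>Y\<^sub>i\<close> vanishes, then \<open>dT = Y\<^sub>i\<^bsup>2m\<^esup> / (L\<^sub>i T\<^bsup>k-1\<^esup>) dY\<^sub>i\<close>, and the factor \<open>Y\<^sub>i\<^bsup>2m\<^esup>\<close>
  compensates for the pole of \<open>1 / Y\<^sub>i\<^bsup>2c\<^sub>i\<^esup>\<close>, as \<open>c\<^sub>i \<le> m\<close>.\<close>

lemma square_form_regular:
  assumes x: "(c, b) \<in> expos" and P: "P \<in> curve"
  shows "regular_at (n + 1) \<iota> \<xi> P (square_form (c, b))"
proof -
  have c: "c i \<le> m" if "i \<in> I" for i using x that by (auto simp: expos_def PiE_iff)
  have b: "b < sum c I" using x by (simp add: expos_def)
  consider "P 2 = 0" | "P 2 \<noteq> 0" "\<forall>i\<in>I. P i \<noteq> 0" | i where "P 2 \<noteq> 0" "i \<in> I" "P i = 0" by blast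
  then show ?thesis
  proof cases
    case 1
    note nz = nonzero_coordinates_at_infinity[OF P 1]
    define w where "w = Z 2 ^ (sum c I - b - 1) * (\<Prod>i\<in>I. inverse (Z i) ^ c i)"
    have "(\<Prod>i\<in>I. inverse (Y i) ^ c i) = Z 2 ^ sum c I * (\<Prod>i\<in>I. inverse (Z i) ^ c i)"
      by (subst Y_eq) (simp add: Z2 power_mult_distrib prod.distrib power_sum)
    also have "Z 2 ^ sum c I = Z 2 ^ b * (Z 2 * Z 2 ^ (sum c I - b - 1))"
      using b by (simp flip: power_Suc power_add)
    finally have "root_of_form (c, b) = (T * Z 2) ^ b * (Z 2 * w)"
      by (simp add: root_of_form_def w_def power_mult_distrib mult_ac)
    then have "root_of_form (c, b) = Z 2 * w" using T_nonzero by (simp add: Z2)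
    then have "(root_of_form (c, b))\<^sup>2 = w\<^sup>2 * DT (Z 2)"
      by (simp add: DT_Z2 power_mult_distrib)
    moreover have "has_value P (w\<^sup>2) (((P 2 / P 1) ^ (sum c I - b - 1) * (\<Prod>i\<in>I. inverse (P i / P 1) ^ c i))\<^sup>2)"
      unfolding w_def using nz
      by (intro has_value_power has_value_mult has_value_prod has_value_inverse value_Z) (auto simp: I_range simp del: atLeastAtMost_iff)
    ultimately show ?thesis
      unfolding square_form_def using value_Z[of P 2, OF nz(1) mem12(2)] by (rule regular_at_scale_dT)
  next
    case 2
    have square: "has_value P ((root_of_form (c, b))\<^sup>2) (((P 1 / P 2) ^ b * (\<Prod>i\<in>I. inverse (P i / P 2) ^ c i))\<^sup>2)"
      unfolding root_of_form_def prod.case using 2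
      by (intro has_value_power has_value_mult has_value_prod has_value_inverse value_Y) (auto simp: I_range simp del: atLeastAtMost_iff)
    have "(root_of_form (c, b))\<^sup>2 = (root_of_form (c, b))\<^sup>2 * DT T" by simp
    from this square value_Y[of P 1, OF 2(1) mem12(1)] show ?thesis
      unfolding square_form_def by (rule regular_at_scale_dT)
  next
    case 3
    note nz = nonzero_coordinates_at_ramification[OF P 3]
    define w where "w = T ^ b * (Y i ^ (m - c i) * (\<Prod>j\<in>I - {i}. inverse (Y j) ^ c j))"
    have w: "root_of_form (c, b) * Y i ^ m = w"
    proof -
      have "Y i ^ m = Y i ^ (m - c i) * Y i ^ c i" using c[OF 3(2)] by (simp flip: power_add)
      then have "inverse (Y i) ^ c i * Y i ^ m = Y i ^ (m - c i)"
        using Y_nonzero[OF 3(2)] by (simp add: power_inverse)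
      then show ?thesis
        unfolding root_of_form_def w_def prod.case using 3(2)
        by (subst prod.remove[of _ i]) (simp_all add: mult_ac)
    qed
    define q where "q = inverse (\<iota> (L i) * T ^ (k - 1))"
    have LT: "\<iota> (L i) * T ^ (k - 1) \<noteq> 0" using L_nonzero[OF 3(2)] T_nonzero by simp
    have "w\<^sup>2 * q * DT (Y i) = (root_of_form (c, b))\<^sup>2 * (q * (Y i ^ (k - 1) * DT (Y i)))"
      unfolding w[symmetric] by (simp add: power_k_diff_one power_mult_distrib mult_ac)
    also have "\<dots> = (root_of_form (c, b))\<^sup>2"
      unfolding DT_equation[OF 3(2)] q_def left_inverse[OF LT] by simp
    finally have "(root_of_form (c, b))\<^sup>2 = w\<^sup>2 * q * DT (Y i)" by simp
    moreover have "has_value P (w\<^sup>2 * q)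
      (((P 1 / P 2) ^ b * ((P i / P 2) ^ (m - c i) * (\<Prod>j\<in>I - {i}. inverse (P j / P 2) ^ c j)))\<^sup>2 *
        inverse (L i * (P 1 / P 2) ^ (k - 1)))"
      unfolding w_def q_def using 3 nz L_nonzero[OF 3(2)]
      by (intro has_value_power has_value_mult has_value_prod has_value_inverse value_Y has_value_const)
         (auto simp: I_range simp del: atLeastAtMost_iff)
    ultimately show ?thesis
      unfolding square_form_def using value_Y[of P i, OF 3(1) I_range(1)[OF 3(2)]] by (rule regular_at_scale_dT)
  qed
qed

lemma square_form_in_kernel:
  assumes "x \<in> expos"
  shows "square_form x \<in> cartier_kernel (n + 1) curve \<iota> \<xi> z"
proof (cases x)
  case (Pair c b)
  then show ?thesis
    using assms square_form_regular[of c b] cartier_square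
    by (auto simp: cartier_kernel_def holomorphic_forms_def square_form_def)
qed

text \<open>Multiplication of \<open>(T\<^sup>b / Y\<^sup>c)\<^sup>2\<close> by \<open>\<Prod> Y\<^sub>i\<^bsup>2m\<^esup>\<close> gives \<open>T\<^bsup>2b\<^esup> Y\<^bsup>2(m-c)\<^esup>\<close>, and \<open>2 m < k\<close>, so these are
  distinct members of the independent family of all \<open>T\<^sup>j Y\<^sup>e\<close>.\<close>

lemma square_forms_independent:
  "inj_on square_form expos" "Om.independent (square_form ` expos)"
proof -
  have main: "u x = 0" if u: "(\<Sum>x\<in>expos. scale_form (\<iota> (u x)) (square_form x)) = 0" and x: "x \<in> expos" for u x
  proof -
    define e where "e c = (\<lambda>i\<in>I. 2 * (m - c i))" for c :: "nat \<Rightarrow> nat"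
    define \<phi> where "\<phi> = (\<lambda>(c, b). (2 * b, e c) :: nat \<times> (nat \<Rightarrow> nat))"
    have inj: "inj_on \<phi> expos"
    proof (rule inj_onI)
      fix x y assume xy: "x \<in> expos" "y \<in> expos" "\<phi> x = \<phi> y"
      obtain c b c' b' where [simp]: "x = (c, b)" "y = (c', b')" by (cases x, cases y)
      have "c i = c' i" for i
      proof (cases "i \<in> I")
        case True
        have "e c i = e c' i" using xy(3) by (simp add: \<phi>_def)
        moreover have "c i \<le> m" "c' i \<le> m" using xy(1,2) True by (auto simp: expos_def PiE_iff)
        ultimately show ?thesis using True by (simp add: e_def)
      next
        case False
        then show ?thesis using xy(1,2) by (auto simp: expos_def PiE_iff extensional_def)
      qed
      then show "x = y" using xy(3) by (auto simp: \<phi>_def)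
    qed
    have root_mon: "(\<Prod>i\<in>I. Y i ^ (2 * m)) * (root_of_form (c, b))\<^sup>2 = T ^ (2 * b) * mon (e c)"
      if "(c, b) \<in> expos" for c b
    proof -
      have "(\<Prod>i\<in>I. Y i ^ (2 * m)) * (root_of_form (c, b))\<^sup>2 =
          T ^ (2 * b) * (\<Prod>i\<in>I. Y i ^ (2 * m) * inverse (Y i) ^ (2 * c i))"
        by (simp add: root_of_form_def power_mult_distrib prod.distrib prod_power_distrib mult_ac flip: power_mult)
      also have "(\<Prod>i\<in>I. Y i ^ (2 * m) * inverse (Y i) ^ (2 * c i)) = mon (e c)"
        unfolding mon_def
      proof (rule prod.cong[OF refl])
        fix i assume i: "i \<in> I"
        then have "c i \<le> m" using that by (auto simp: expos_def PiE_iff)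
        then have "2 * m = 2 * (m - c i) + 2 * c i" by simp
        from arg_cong[OF this, of "\<lambda>j. Y i ^ j"]
        have "Y i ^ (2 * m) = Y i ^ (2 * (m - c i)) * Y i ^ (2 * c i)" by (simp only: power_add)
        then show "Y i ^ (2 * m) * inverse (Y i) ^ (2 * c i) = Y i ^ e c i"
          using i Y_nonzero[OF i] by (simp add: e_def power_inverse)
      qed
      finally show ?thesis .
    qed
    have "(\<Sum>x\<in>expos. scale_form (\<iota> (u x)) (square_form x)) DT = (\<Sum>x\<in>expos. \<iota> (u x) * (root_of_form x)\<^sup>2)"
      using finite_expos
      by (induction rule: finite_induct)
         (simp_all add: scale_form_def square_form_def differential_def derivation_DT)
    then have "(\<Sum>x\<in>expos. \<iota> (u x) * (root_of_form x)\<^sup>2) = 0" using u by simp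
    then have "0 = (\<Prod>i\<in>I. Y i ^ (2 * m)) * (\<Sum>x\<in>expos. \<iota> (u x) * (root_of_form x)\<^sup>2)" by simp
    also have "\<dots> = (\<Sum>x\<in>expos. \<iota> (u x) * (T ^ fst (\<phi> x) * mon (snd (\<phi> x))))"
      unfolding sum_distrib_left
    proof (rule sum.cong[OF refl])
      fix x assume x: "x \<in> expos"
      obtain c b where cb: "x = (c, b)" by (cases x)
      show "(\<Prod>i\<in>I. Y i ^ (2 * m)) * (\<iota> (u x) * (root_of_form x)\<^sup>2) = \<iota> (u x) * (T ^ fst (\<phi> x) * mon (snd (\<phi> x)))"
        using root_mon[of c b] x by (simp add: cb \<phi>_def mult.left_commute)
    qed
    also have "\<dots> = (\<Sum>y\<in>\<phi> ` expos. \<iota> (u (the_inv_into expos \<phi> y)) * (T ^ fst y * mon (snd y)))"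
      by (simp add: sum.reindex[OF inj] the_inv_into_f_f[OF inj])
    finally have "(\<Sum>(j, e)\<in>\<phi> ` expos. \<iota> ((u \<circ> the_inv_into expos \<phi>) (j, e)) * (T ^ j * mon e)) = 0"
      by (simp add: case_prod_unfold)
    moreover have "\<phi> ` expos \<subseteq> UNIV \<times> Box"
    proof -
      have "2 * (m - j) < k" for j using k_eq by linarith
      then show ?thesis by (auto simp: \<phi>_def Box_def e_def PiE_iff)
    qed
    ultimately have "(u \<circ> the_inv_into expos \<phi>) (fst (\<phi> x), snd (\<phi> x)) = 0"
      by (intro monomials_independent[where A = "\<phi> ` expos"]) (use x in auto)
    then show ?thesis using the_inv_into_f_f[OF inj x] by simp
  qed
  show "inj_on square_form expos" "Om.independent (square_form ` expos)"
    by (rule Om.independent_family[OF finite_expos]; rule main; assumption)+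
qed

lemma card_expos: "2 * card expos = card I * m * (m + 1) ^ card I"
proof -
  have "card expos = (\<Sum>c\<in>Pi\<^sub>E I (\<lambda>_. {..m}). sum c I)"
    unfolding expos_def by (subst card_SigmaI) (auto intro!: finite_PiE)
  then show ?thesis using sum_over_box[OF finite_I] by simp
qed

text \<open>A basis of the kernel is finite, because it is independent and lies in the span of
  \<open>form_gens\<close>; only then its cardinality bounds that of the independent set \<open>square_form ` expos\<close>.\<close>

lemma card_expos_le_a_number: "card expos \<le> a_number (n + 1) curve \<iota> \<xi> z"
proof -
  let ?K = "cartier_kernel (n + 1) curve \<iota> \<xi> z"
  obtain B where B: "B \<subseteq> ?K" "Om.independent B" "?K \<subseteq> Om.span B" "card B = Om.dim ?K"
    by (rule Om.basis_exists)
  have "finite B"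
  proof -
    have "finite form_gens" by (simp add: form_gens_def)
    moreover have "B \<subseteq> Om.span form_gens"
      using B(1) holomorphic_in_span by (auto simp: cartier_kernel_def)
    ultimately show ?thesis using Om.independent_span_bound[OF _ B(2)] by blast
  qed
  moreover have "square_form ` expos \<subseteq> Om.span B" using square_form_in_kernel B(3) by blast
  ultimately have "card (square_form ` expos) \<le> card B"
    using Om.independent_span_bound square_forms_independent(2) by blast
  then show ?thesis
    using card_image[OF square_forms_independent(1)] B(4) by (simp add: a_number_def)
qed

end

theorem theorem5p2:
  fixes k n :: nat and l :: "nat \<Rightarrow> 'a::alg_closed_field"
    and \<iota> :: "'a \<Rightarrow> 'f::field" and \<xi> :: "nat \<Rightarrow> 'f" and z :: 'f
  assumes "CHAR('a) = 2"
    and "k \<ge> 3" and "odd k" and "n \<ge> 2"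
    and "\<forall>j\<in>{1..n - 2}. l j \<noteq> 0 \<and> l j \<noteq> 1"
    and "inj_on l {1..n - 2}"
    and "function_field (n + 1) (fermat_curve k n l) \<iota> \<xi>"
    and "z \<notin> range (\<lambda>u. u ^ CHAR('f))"
  shows "real (a_number (n + 1) (fermat_curve k n l) \<iota> \<xi> z)
           \<ge> (real n - 1) * (real k - 1) / 4 * ((real k + 1) / 2) ^ (n - 1)"
proof -
  interpret function_field "n + 1" "fermat_curve k n l" \<iota> \<xi> by fact
  interpret F: fermat_function_field n k l \<iota> \<xi>
    by unfold_locales (fact assms)+
  interpret F: fermat_nonsquare n k l \<iota> \<xi> z
    by unfold_locales (use assms(8) F.char_two_ff in simp)
  have card_I: "card F.I = n - 1" by (simp add: F.I_def)
  have k: "real k = 2 * real F.m + 1" using F.k_eq by linarith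
  have "2 * real (card F.expos) = (real n - 1) * real F.m * (real F.m + 1) ^ (n - 1)"
    using arg_cong[OF F.card_expos, of real] assms(4) by (simp add: card_I of_nat_diff)
  moreover have "(real n - 1) * (real k - 1) / 4 = (real n - 1) * real F.m / 2"
    and "(real k + 1) / 2 = real F.m + 1"
    by (simp_all add: k)
  ultimately have "(real n - 1) * (real k - 1) / 4 * ((real k + 1) / 2) ^ (n - 1) = real (card F.expos)"
    by (simp only: times_divide_eq_left)
  also have "\<dots> \<le> real (a_number (n + 1) (fermat_curve k n l) \<iota> \<xi> z)"
    using F.card_expos_le_a_number by simp
  finally show ?thesis .
qed

end
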